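(* When a Boolean network $f:\mathbb{B}^n\to\mathbb{B}^n$ is given as input by its functional graph, the problems TRAPSPACE (given a sub-hypercube $\mathbf{h}$, decide whether $\mathbf{h}$ is a trap space of $f$), MINTRAP (given a sub-hypercube $\mathbf{h}$, decide whether $\mathbf{h}$ is a minimal trap space of $f$) and IN-MINTRAP (given a configuration $\mathbf{x}\in\mathbb{B}^n$, decide whether $\mathbf{x}$ is a vertex of some minimal trap space of $f$) are all decidable in polynomial time (in the size of the input).
   Context: $\mathbb{B}=\{0,1\}$. A Boolean network of dimension $n$ is a map $f:\mathbb{B}^n\to\mathbb{B}^n$. Its functional graph is the digraph $G=(V,E)$ with $V=\mathbb{B}^n$ and $E=\{(\mathbf{x},f(\mathbf{x})):\mathbf{x}\in\mathbb{B}^n\}$, given explicitly (input size proportional to $|V|+|E|$). A sub-hypercube is a vector $\mathbf{h}\in\{0,1,*\}^n$ with vertex set $v(\mathbf{h})=\{\mathbf{x}\in\mathbb{B}^n:\forall i,\ \mathbf{h}_i\neq *\Rightarrow\mathbf{x}_i=\mathbf{h}_i\}$. A trap space of $f$ is a sub-hypercube $\mathbf{h}$ with $f(\mathbf{x})\in v(\mathbf{h})$ for all $\mathbf{x}\in v(\mathbf{h})$; it is minimal if there is no trap space $\mathbf{h}'$ with $v(\mathbf{h}')\subsetneq v(\mathbf{h})$. *)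

theory Defs
  imports "HOL-Library.FuncSet" "HOL-Computational_Algebra.Polynomial"
begin

definition configs :: "nat \<Rightarrow> bool list set" where
  "configs n = {x. length x = n}"

definition boolean_network :: "nat \<Rightarrow> (bool list \<Rightarrow> bool list) \<Rightarrow> bool" where
  "boolean_network n f \<longleftrightarrow> f \<in> configs n \<rightarrow> configs n"

definition functional_graph ::
    "nat \<Rightarrow> (bool list \<Rightarrow> bool list) \<Rightarrow> bool list set \<times> (bool list \<times> bool list) set" where
  "functional_graph n f = (configs n, {(x, f x) | x. x \<in> configs n})"

text \<open>A sub-hypercube of dimension \<open>n\<close> is a list of length \<open>n\<close>; \<open>None\<close> stands for \<open>*\<close>.\<close>

type_synonym hypercube = "bool option list"

definition vertices :: "hypercube \<Rightarrow> bool list set" where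
  "vertices h = {x \<in> configs (length h). \<forall>i < length h. h ! i \<noteq> None \<longrightarrow> Some (x ! i) = h ! i}"

definition trap_space :: "nat \<Rightarrow> (bool list \<Rightarrow> bool list) \<Rightarrow> hypercube \<Rightarrow> bool" where
  "trap_space n f h \<longleftrightarrow> length h = n \<and> (\<forall>x \<in> vertices h. f x \<in> vertices h)"

definition minimal_trap_space :: "nat \<Rightarrow> (bool list \<Rightarrow> bool list) \<Rightarrow> hypercube \<Rightarrow> bool" where
  "minimal_trap_space n f h \<longleftrightarrow>
     trap_space n f h \<and> \<not> (\<exists>h'. trap_space n f h' \<and> vertices h' \<subset> vertices h)"

text \<open>Deterministic multi-tape Turing machines. States are the numbers below \<open>num_states\<close>,
  tape symbols the numbers below \<open>num_symbols\<close>, and \<open>0\<close> is the blank. A transition maps the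
  current state and the scanned symbols, one per tape, to the new state and, for each tape, the
  symbol to be written and the head move made afterwards. Tapes are infinite in both directions.\<close>

datatype head_move = MoveLeft | Stay | MoveRight

record tm =
  num_tapes :: nat
  num_states :: nat
  num_symbols :: nat
  start_state :: nat
  accept_state :: nat
  reject_state :: nat
  transition :: "nat \<Rightarrow> nat list \<Rightarrow> nat \<times> (nat \<times> head_move) list"

definition wf_tm :: "tm \<Rightarrow> bool" where
  "wf_tm M \<longleftrightarrow>
     num_tapes M \<ge> 1 \<and> num_symbols M \<ge> 1 \<and>
     start_state M < num_states M \<and> accept_state M < num_states M \<and>
     reject_state M < num_states M \<and> accept_state M \<noteq> reject_state M \<and>
     (\<forall>q < num_states M. \<forall>ss. length ss = num_tapes M \<and> set ss \<subseteq> {..<num_symbols M} \<longrightarrow>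
        (case transition M q ss of (q', as) \<Rightarrow>
           q' < num_states M \<and> length as = num_tapes M \<and> fst ` set as \<subseteq> {..<num_symbols M}))"

type_synonym tape = "(int \<Rightarrow> nat) \<times> int"

type_synonym tm_config = "nat \<times> tape list"

fun scanned :: "tape \<Rightarrow> nat" where
  "scanned (c, p) = c p"

fun shift :: "head_move \<Rightarrow> int \<Rightarrow> int" where
  "shift MoveLeft p = p - 1"
| "shift Stay p = p"
| "shift MoveRight p = p + 1"

fun act :: "nat \<times> head_move \<Rightarrow> tape \<Rightarrow> tape" where
  "act (s, m) (c, p) = (c(p := s), shift m p)"

fun step :: "tm \<Rightarrow> tm_config \<Rightarrow> tm_config" where
  "step M (q, ts) =
     (if q = accept_state M \<or> q = reject_state M then (q, ts)
      else case transition M q (map scanned ts) of (q', as) \<Rightarrow> (q', map2 act as ts))"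

definition word_tape :: "nat list \<Rightarrow> tape" where
  "word_tape w = (\<lambda>i. if 0 \<le> i \<and> i < int (length w) then w ! nat i else 0, 0)"

definition initial_config :: "tm \<Rightarrow> nat list \<Rightarrow> tm_config" where
  "initial_config M w =
     (start_state M, word_tape w # replicate (num_tapes M - 1) (word_tape []))"

definition state_after :: "tm \<Rightarrow> nat list \<Rightarrow> nat \<Rightarrow> nat" where
  "state_after M w t = fst ((step M ^^ t) (initial_config M w))"

text \<open>The input alphabet is \<open>{1..s}\<close>. Accepting and rejecting configurations are fixed by
  \<^const>\<open>step\<close>, so being in such a state at time \<open>t\<close> means having halted within \<open>t\<close> steps.\<close>

definition decides_in_time :: "tm \<Rightarrow> nat \<Rightarrow> nat list set \<Rightarrow> (nat \<Rightarrow> nat) \<Rightarrow> bool" where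
  "decides_in_time M s L T \<longleftrightarrow>
     wf_tm M \<and> s < num_symbols M \<and>
     (\<forall>w \<in> lists {1..s}. state_after M w (T (length w)) =
        (if w \<in> L then accept_state M else reject_state M))"

definition polytime_decidable :: "nat \<Rightarrow> nat list set \<Rightarrow> bool" where
  "polytime_decidable s L \<longleftrightarrow>
     L \<subseteq> lists {1..s} \<and> (\<exists>M (p :: nat poly). decides_in_time M s L (poly p))"

text \<open>Instances are words over \<open>{1..4}\<close>: \<open>1\<close> and \<open>2\<close> are the bits, \<open>3\<close> is \<open>*\<close>, and \<open>4\<close>
  terminates each vector. The graph is given by its edges in arbitrary order, without
  repetition; every vertex occurs exactly once as a source, so the vertex set needs no
  separate listing.\<close>

fun encode_entry :: "bool option \<Rightarrow> nat" where
  "encode_entry (Some False) = 1"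
| "encode_entry (Some True) = 2"
| "encode_entry None = 3"

definition encode_hypercube :: "hypercube \<Rightarrow> nat list" where
  "encode_hypercube h = map encode_entry h @ [4]"

definition encode_config :: "bool list \<Rightarrow> nat list" where
  "encode_config x = map (\<lambda>b. encode_entry (Some b)) x @ [4]"

definition encode_edges :: "(bool list \<times> bool list) list \<Rightarrow> nat list" where
  "encode_edges es = concat (map (\<lambda>(x, y). encode_config x @ encode_config y) es)"

definition lists_graph ::
    "(bool list \<times> bool list) list \<Rightarrow> nat \<Rightarrow> (bool list \<Rightarrow> bool list) \<Rightarrow> bool" where
  "lists_graph es n f \<longleftrightarrow> distinct es \<and> set es = snd (functional_graph n f)"

definition TRAPSPACE :: "nat list set" where
  "TRAPSPACE = {encode_hypercube h @ encode_edges es | n f h es.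
     boolean_network n f \<and> lists_graph es n f \<and> length h = n \<and> trap_space n f h}"

definition MINTRAP :: "nat list set" where
  "MINTRAP = {encode_hypercube h @ encode_edges es | n f h es.
     boolean_network n f \<and> lists_graph es n f \<and> length h = n \<and> minimal_trap_space n f h}"

definition IN_MINTRAP :: "nat list set" where
  "IN_MINTRAP = {encode_config x @ encode_edges es | n f x es.
     boolean_network n f \<and> lists_graph es n f \<and> x \<in> configs n \<and>
     (\<exists>h. minimal_trap_space n f h \<and> x \<in> vertices h)}"

end

theory Submission
  imports Defs
begin

text \<open>The minimal trap spaces are closures of configurations: sweeping through the edges \<open>(x, y)\<close> and
  freeing, whenever \<open>x\<close> lies in the current cube, the coordinates in which \<open>y\<close> leaves it,
  reaches after at most \<open>n\<close> sweeps the least trap space containing the start. Hence \<open>h\<close> is a minimal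
  trap space iff it is the closure of each of its vertices, and \<open>x\<close> lies in a minimal trap space iff
  its own closure is minimal. Every closure costs polynomially many passes over the graph.

  To obtain Turing machines, the algorithms are written in a language of stack operations whose only
  loops run exactly \<open>N\<close> times, \<open>N\<close> being the input length. Each loop is driven by a copy of
  the input on a tape of its own, so a running time polynomial in \<open>N\<close> is read off the syntax.\<close>

section \<open>A stack language with clocked loops\<close>

text \<open>A cube can have exponentially many vertices in \<open>n\<close>, but the input lists
  every configuration as the source of an edge, so a quantifier over the vertices of a cube becomes
  one pass over the edges. Closures add only what is forced: a trap space that contains the current
  cube, and in it the source of an edge, contains the target and hence the least cube around both.

  Malformed words have to be rejected as well. Besides parsing, this means recognising the graph of
  a map; no missing vertex is searched for, since \<open>2 ^ n\<close> edges with pairwise distinct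
  sources of length \<open>n\<close> leave none out.

  A clocked loop can neither stop early nor run just \<open>n\<close> times. Bodies are therefore
  written so that they change nothing once their work is done, and closures use \<open>N\<close>
  sweeps instead of \<open>n\<close>, the surplus ones repeating a fixed point. The dimension, the
  number of edges and the length of the edge list of a well-formed input are all at most
  \<open>N\<close>, so one clock length serves every loop.\<close>

datatype cmd =
    Skip
  | Push nat nat
  | Pop nat
  | Test nat nat cmd cmd
  | Seq cmd cmd (infixr \<open>;;\<close> 60)
  | Loop cmd

type_synonym store = "nat \<Rightarrow> nat list"

text \<open>An empty stack shows 0, the blank of the tapes, so \<open>Test i 0\<close> asks for
  emptiness; the programs below push nonzero symbols only.\<close>

definition peek :: "nat list \<Rightarrow> nat" where
  "peek xs = (case xs of [] \<Rightarrow> 0 | x # _ \<Rightarrow> x)"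

primrec eval :: "nat \<Rightarrow> cmd \<Rightarrow> store \<Rightarrow> store" where
  "eval N Skip \<sigma> = \<sigma>"
| "eval N (Push i s) \<sigma> = \<sigma>(i := s # \<sigma> i)"
| "eval N (Pop i) \<sigma> = \<sigma>(i := tl (\<sigma> i))"
| "eval N (Test i s c1 c2) \<sigma> = (if peek (\<sigma> i) = s then eval N c1 \<sigma> else eval N c2 \<sigma>)"
| "eval N (c1 ;; c2) \<sigma> = eval N c2 (eval N c1 \<sigma>)"
| "eval N (Loop c) \<sigma> = (eval N c ^^ N) \<sigma>"

primrec wf_cmd :: "nat \<Rightarrow> nat \<Rightarrow> cmd \<Rightarrow> bool" where
  "wf_cmd R S Skip \<longleftrightarrow> True"
| "wf_cmd R S (Push i s) \<longleftrightarrow> i < R \<and> s < S"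
| "wf_cmd R S (Pop i) \<longleftrightarrow> i < R"
| "wf_cmd R S (Test i s c1 c2) \<longleftrightarrow> i < R \<and> wf_cmd R S c1 \<and> wf_cmd R S c2"
| "wf_cmd R S (c1 ;; c2) \<longleftrightarrow> wf_cmd R S c1 \<and> wf_cmd R S c2"
| "wf_cmd R S (Loop c) \<longleftrightarrow> wf_cmd R S c"

primrec depth :: "cmd \<Rightarrow> nat" where
  "depth Skip = 0"
| "depth (Push i s) = 0"
| "depth (Pop i) = 0"
| "depth (Test i s c1 c2) = max (depth c1) (depth c2)"
| "depth (c1 ;; c2) = max (depth c1) (depth c2)"
| "depth (Loop c) = Suc (depth c)"

section \<open>Compilation to Turing machines\<close>

text \<open>A machine step writes before it moves, whereas a push has to move to the free cell
  first; hence its two states. Even \<open>Skip\<close> owns a state, so that every block has an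
  entry of its own. A loop adds its entry state and a state for rewinding the clock.\<close>

primrec code_size :: "cmd \<Rightarrow> nat" where
  "code_size Skip = 1"
| "code_size (Push i s) = 2"
| "code_size (Pop i) = 1"
| "code_size (Test i s c1 c2) = 1 + code_size c1 + code_size c2"
| "code_size (c1 ;; c2) = code_size c1 + code_size c2"
| "code_size (Loop c) = 2 + code_size c"

definition keep :: "nat list \<Rightarrow> (nat \<times> head_move) list" where
  "keep ss = map (\<lambda>s. (s, Stay)) ss"

definition move :: "nat \<Rightarrow> head_move \<Rightarrow> nat list \<Rightarrow> (nat \<times> head_move) list" where
  "move k m ss = (keep ss)[k := (ss ! k, m)]"

text \<open>The code of a command occupies the states from \<open>b\<close> on and is left through state \<open>e\<close>.
  The first \<open>R\<close> tapes are the registers, the others are clocks: a loop whose body has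
  depth \<open>d\<close> is driven by clock \<open>d\<close>, which no loop inside its body touches.\<close>

primrec code :: "nat \<Rightarrow> cmd \<Rightarrow> nat \<Rightarrow> nat \<Rightarrow> nat \<Rightarrow> nat list \<Rightarrow> nat \<times> (nat \<times> head_move) list" where
  "code R Skip b e q ss = (e, keep ss)"
| "code R (Push i s) b e q ss =
     (if q = b then (Suc b, move i MoveLeft ss) else (e, (keep ss)[i := (s, Stay)]))"
| "code R (Pop i) b e q ss = (e, move i MoveRight ss)"
| "code R (Test i s c1 c2) b e q ss =
     (if q = b then (if ss ! i = s then Suc b else Suc b + code_size c1, keep ss)
      else if q < Suc b + code_size c1 then code R c1 (Suc b) e q ss
      else code R c2 (Suc b + code_size c1) e q ss)"
| "code R (c1 ;; c2) b e q ss =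
     (if q < b + code_size c1 then code R c1 b (b + code_size c1) q ss
      else code R c2 (b + code_size c1) e q ss)"
| "code R (Loop c) b e q ss =
     (let k = R + depth c; r = Suc b + code_size c in
      if q = b then
        (if ss ! k \<noteq> 0 then (Suc b, move k MoveRight ss) else (r, move k MoveLeft ss))
      else if q = r then
        (if ss ! k \<noteq> 0 then (r, move k MoveLeft ss) else (e, move k MoveRight ss))
      else code R c (Suc b) b q ss)"

text \<open>A loop of \<open>N\<close> rounds costs \<open>N\<close> entry steps and bodies, one
  step to turn at the end of the clock, \<open>N\<close> steps back and one step onto the first
  cell. A test is charged for both branches, which keeps the bound a polynomial without taking
  maxima.\<close>

primrec time :: "cmd \<Rightarrow> nat poly" where
  "time Skip = 1"
| "time (Push i s) = 2"
| "time (Pop i) = 1"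
| "time (Test i s c1 c2) = 1 + time c1 + time c2"
| "time (c1 ;; c2) = time c1 + time c2"
| "time (Loop c) = [:0, 1:] * (2 + time c) + 2"

lemma code_size_pos: "0 < code_size c"
  by (induction c) auto

lemma length_keep [simp]: "length (keep ss) = length ss"
  by (simp add: keep_def)

lemma length_move [simp]: "length (move k m ss) = length ss"
  by (simp add: move_def)

lemma set_keep: "fst ` set (keep ss) = set ss"
  by (auto simp: keep_def image_image)

lemma set_update_keep:
  assumes "set ss \<subseteq> A" "s \<in> A"
  shows "fst ` set ((keep ss)[i := (s, m)]) \<subseteq> A"
  using assms set_update_subset_insert[of "keep ss" i "(s, m)"] set_keep[of ss] by fastforce

lemma set_move:
  assumes "set ss \<subseteq> A" shows "fst ` set (move k m ss) \<subseteq> A"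
proof (cases "k < length ss")
  case True
  then show ?thesis
    unfolding move_def using assms by (intro set_update_keep) auto
next
  case False
  then show ?thesis
    using assms by (simp add: move_def set_keep list_update_beyond)
qed

lemma wf_code:
  assumes "wf_cmd R S c" "set ss \<subseteq> {..<S}" "b \<le> q" "q < b + code_size c"
    "b + code_size c \<le> K" "e < K"
  shows "fst (code R c b e q ss) < K \<and> length (snd (code R c b e q ss)) = length ss
    \<and> fst ` set (snd (code R c b e q ss)) \<subseteq> {..<S}"
  using assms
proof (induction c arbitrary: b e)
  case (Test i s c1 c2)
  have "b + 1 + code_size c1 < b + code_size (Test i s c1 c2)" "b + 1 < b + code_size (Test i s c1 c2)"
    using code_size_pos[of c1] code_size_pos[of c2] by auto
  then show ?case
    using Test.IH(1)[of "Suc b" e] Test.IH(2)[of "Suc b + code_size c1" e] Test.prems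
    by (auto simp: set_keep)
next
  case (Seq c1 c2)
  show ?case
    using Seq.IH(1)[of b "b + code_size c1"] Seq.IH(2)[of "b + code_size c1" e] Seq.prems
      code_size_pos[of c2]
    by auto
next
  case (Loop c)
  show ?case
    using Loop.IH[of "Suc b" b] Loop.prems code_size_pos[of c] set_move[of ss "{..<S}"]
    by (auto simp: Let_def)
qed (use set_keep[of ss] set_move[of ss "{..<S}"] set_update_keep[of ss "{..<S}"] in auto)

text \<open>The top is under the head and the stack extends to the right. Nothing is said about the
  cells on the left: a pop just moves right and leaves its symbol behind, and a later push
  overwrites it.\<close>

definition stack_tape :: "nat list \<Rightarrow> tape \<Rightarrow> bool" where
  "stack_tape xs t \<longleftrightarrow> (\<forall>i. fst t (snd t + int i) = (if i < length xs then xs ! i else 0))"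

text \<open>The right blank ends the loop and the left one ends the rewinding. Any word without
  blanks can be a clock, in particular the input.\<close>

definition clock_tape :: "nat \<Rightarrow> tape \<Rightarrow> bool" where
  "clock_tape N t \<longleftrightarrow> fst t (snd t - 1) = 0 \<and> fst t (snd t + int N) = 0 \<and>
     (\<forall>i<N. fst t (snd t + int i) \<noteq> 0)"

lemma stack_tape_scanned: "stack_tape xs t \<Longrightarrow> scanned t = peek xs"
  by (cases t; cases xs) (auto simp: stack_tape_def peek_def dest: spec[of _ 0])

text \<open>Popping an empty stack moves the head further over blanks, which again represents the
  empty stack, in accordance with \<open>tl [] = []\<close>.\<close>

lemma stack_tape_pop:
  assumes "stack_tape xs t" shows "stack_tape (tl xs) (act (scanned t, MoveRight) t)"
proof (cases t)
  case (Pair c p)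
  have "c (p + 1 + int i) = (if i < length (tl xs) then tl xs ! i else 0)" for i
    using assms[unfolded stack_tape_def, rule_format, of "Suc i"] Pair
    by (cases xs) (auto simp: add.assoc)
  then show ?thesis
    using Pair by (simp add: stack_tape_def)
qed

lemma stack_tape_push:
  assumes "stack_tape xs t"
  shows "stack_tape (s # xs) (act (s, Stay) (act (scanned t, MoveLeft) t))"
proof (cases t)
  case (Pair c p)
  have "(c(p := c p, p - 1 := s)) (p - 1 + int i) = (if i < length (s # xs) then (s # xs) ! i else 0)" for i
    using assms[unfolded stack_tape_def, rule_format, of "i - 1"] Pair
    by (cases i) (auto simp: add.assoc)
  then show ?thesis
    using Pair by (simp add: stack_tape_def)
qed

lemma act_update:
  "k < length ts \<Longrightarrow> map2 act ((keep (map scanned ts))[k := a]) ts = ts[k := act a (ts ! k)]"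
  by (rule nth_equalityI) (auto simp: keep_def nth_list_update simp del: act.simps, (metis act.simps fun_upd_triv scanned.simps shift.simps(2) surj_pair)+)

lemma act_keep: "map2 act (keep (map scanned ts)) ts = ts"
  by (rule nth_equalityI) (auto simp: keep_def simp del: act.simps, metis act.simps fun_upd_triv scanned.simps shift.simps(2) surj_pair)

lemma act_move:
  "k < length ts \<Longrightarrow> map2 act (move k m (map scanned ts)) ts =
     ts[k := act (scanned (ts ! k), m) (ts ! k)]"
  by (simp add: move_def act_update)

lemma act_scanned: "c p = s \<Longrightarrow> act (s, m) (c, p) = (c, shift m p)"
  by auto

text \<open>An upper bound on the number of steps lets branches of different cost share one
  polynomial. The exact time required by \<open>decides_in_time\<close> is recovered at the end,
  where halting configurations are fixed points.\<close>

definition reaches :: "tm \<Rightarrow> nat \<Rightarrow> tm_config \<Rightarrow> tm_config \<Rightarrow> bool" where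
  "reaches M T x y \<longleftrightarrow> (\<exists>t\<le>T. (step M ^^ t) x = y)"

lemma reaches_refl: "reaches M T x x"
  unfolding reaches_def by (rule exI[of _ 0]) simp

lemma reaches_trans:
  assumes "reaches M T x y" "reaches M U y z" shows "reaches M (T + U) x z"
proof -
  obtain t u where "t \<le> T" "(step M ^^ t) x = y" "u \<le> U" "(step M ^^ u) y = z"
    using assms unfolding reaches_def by auto
  then have "(step M ^^ (u + t)) x = z" "u + t \<le> T + U"
    by (auto simp: funpow_add)
  then show ?thesis
    unfolding reaches_def by blast
qed

lemma reaches_step: "step M x = y \<Longrightarrow> reaches M 1 x y"
  unfolding reaches_def by (rule exI[of _ 1]) simp

lemma reaches_Suc:
  assumes "step M x = y" "reaches M T y z" shows "reaches M (Suc T) x z"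
  using reaches_trans[OF reaches_step[OF assms(1)] assms(2)] by simp

lemma reaches_mono: "reaches M T x y \<Longrightarrow> T \<le> U \<Longrightarrow> reaches M U x y"
  unfolding reaches_def using le_trans by blast

declare step.simps [simp del]

section \<open>Simulation of commands by their code\<close>

definition runs_code :: "tm \<Rightarrow> nat \<Rightarrow> cmd \<Rightarrow> nat \<Rightarrow> nat \<Rightarrow> bool" where
  "runs_code M R c b e \<longleftrightarrow> (\<forall>q. b \<le> q \<and> q < b + code_size c \<longrightarrow>
     q \<noteq> accept_state M \<and> q \<noteq> reject_state M \<and> transition M q = code R c b e q)"

lemma step_code:
  assumes "runs_code M R c b e" "b \<le> q" "q < b + code_size c"
    "code R c b e q (map scanned ts) = (q', as)" "map2 act as ts = ts'"
  shows "step M (q, ts) = (q', ts')"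
  using assms unfolding runs_code_def by (auto simp: step.simps)

text \<open>The clocks come back as the very same tapes, head positions included. This is what
  allows consecutive commands and the rounds of an outer loop to use them again, and what keeps the
  clock of a loop in place while its body runs.\<close>

lemma code_correct:
  assumes "runs_code M R c b e" "wf_cmd R S c" "R + depth c \<le> length ts"
    "\<forall>i<R. stack_tape (\<sigma> i) (ts ! i)" "\<forall>d<depth c. clock_tape N (ts ! (R + d))"
  shows "\<exists>ts'. reaches M (poly (time c) N) (b, ts) (e, ts') \<and> length ts' = length ts \<and>
    (\<forall>i<R. stack_tape (eval N c \<sigma> i) (ts' ! i)) \<and> (\<forall>i\<ge>R. i < length ts \<longrightarrow> ts' ! i = ts ! i)"
  using assms
proof (induction c arbitrary: b e \<sigma> ts)
  case Skip
  have "step M (b, ts) = (e, ts)"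
    using Skip.prems by (intro step_code[OF Skip.prems(1)]) (auto simp: act_keep)
  then show ?case
    using Skip.prems by (intro exI[of _ ts]) (auto intro: reaches_step[unfolded One_nat_def])
next
  case (Push i s)
  define ts1 where "ts1 = ts[i := act (scanned (ts ! i), MoveLeft) (ts ! i)]"
  define ts2 where "ts2 = ts1[i := act (s, Stay) (ts1 ! i)]"
  have i: "i < length ts" "i < length ts1" "i < R"
    using Push.prems by (auto simp: ts1_def)
  have "step M (b, ts) = (Suc b, ts1)"
    using i by (intro step_code[OF Push.prems(1)]) (auto simp: act_move ts1_def)
  moreover have "step M (Suc b, ts1) = (e, ts2)"
    using i by (intro step_code[OF Push.prems(1)]) (auto simp: act_update ts2_def)
  ultimately have "reaches M 2 (b, ts) (e, ts2)"
    using reaches_Suc[OF _ reaches_step] by (metis Suc_1)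
  moreover have "stack_tape (eval N (Push i s) \<sigma> j) (ts2 ! j)" if "j < R" for j
    using Push.prems that i stack_tape_push[of "\<sigma> i" "ts ! i" s]
    by (auto simp: ts1_def ts2_def nth_list_update simp del: act.simps)
  ultimately show ?case
    using Push.prems i by (intro exI[of _ ts2]) (auto simp: ts1_def ts2_def)
next
  case (Pop i)
  define ts1 where "ts1 = ts[i := act (scanned (ts ! i), MoveRight) (ts ! i)]"
  have i: "i < length ts" "i < R"
    using Pop.prems by auto
  have "step M (b, ts) = (e, ts1)"
    using i by (intro step_code[OF Pop.prems(1)]) (auto simp: act_move ts1_def)
  moreover have "stack_tape (eval N (Pop i) \<sigma> j) (ts1 ! j)" if "j < R" for j
    using Pop.prems that i stack_tape_pop[of "\<sigma> i" "ts ! i"]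
    by (auto simp: ts1_def nth_list_update simp del: act.simps)
  ultimately show ?case
    using Pop.prems i by (intro exI[of _ ts1]) (auto simp: ts1_def intro: reaches_step[unfolded One_nat_def])
next
  case (Test i s c1 c2)
  have i: "i < length ts" "i < R" and top: "scanned (ts ! i) = peek (\<sigma> i)"
    using Test.prems by (auto intro!: stack_tape_scanned)
  have prems: "wf_cmd R S c1" "wf_cmd R S c2" "\<forall>d<depth c1. clock_tape N (ts ! (R + d))" "\<forall>d<depth c2. clock_tape N (ts ! (R + d))"
    "R + depth c1 \<le> length ts" "R + depth c2 \<le> length ts"
    using Test.prems by auto
  have "runs_code M R c1 (Suc b) e"
    using Test.prems(1) code_size_pos[of c1] unfolding runs_code_def by auto
  then obtain ts1 where 1: "reaches M (poly (time c1) N) (Suc b, ts) (e, ts1)" "length ts1 = length ts"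
    "\<forall>i<R. stack_tape (eval N c1 \<sigma> i) (ts1 ! i)" "\<forall>i\<ge>R. i < length ts \<longrightarrow> ts1 ! i = ts ! i"
    using Test.IH(1)[OF _ prems(1,5) Test.prems(4) prems(3)] by blast
  have "runs_code M R c2 (Suc b + code_size c1) e"
    using Test.prems(1) unfolding runs_code_def by auto
  then obtain ts2 where 2: "reaches M (poly (time c2) N) (Suc b + code_size c1, ts) (e, ts2)"
    "length ts2 = length ts" "\<forall>i<R. stack_tape (eval N c2 \<sigma> i) (ts2 ! i)"
    "\<forall>i\<ge>R. i < length ts \<longrightarrow> ts2 ! i = ts ! i"
    using Test.IH(2)[OF _ prems(2,6) Test.prems(4) prems(4)] by blast
  have "step M (b, ts) = (if peek (\<sigma> i) = s then Suc b else Suc b + code_size c1, ts)"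
    using i top by (intro step_code[OF Test.prems(1)]) (auto simp: act_keep)
  then have "reaches M (Suc (if peek (\<sigma> i) = s then poly (time c1) N else poly (time c2) N))
      (b, ts) (e, if peek (\<sigma> i) = s then ts1 else ts2)"
    using reaches_Suc[OF _ 1(1)] reaches_Suc[OF _ 2(1)] by simp
  then have "reaches M (poly (time (Test i s c1 c2)) N) (b, ts) (e, if peek (\<sigma> i) = s then ts1 else ts2)"
    by (rule reaches_mono) simp
  then show ?case
    using 1 2 by (intro exI[of _ "if peek (\<sigma> i) = s then ts1 else ts2"]) auto
next
  case (Seq c1 c2)
  have prems: "wf_cmd R S c1" "wf_cmd R S c2" "\<forall>d<depth c1. clock_tape N (ts ! (R + d))"
    "\<forall>d<depth c2. clock_tape N (ts ! (R + d))" "R + depth c1 \<le> length ts" "R + depth c2 \<le> length ts"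
    using Seq.prems by auto
  have "runs_code M R c1 b (b + code_size c1)"
    using Seq.prems(1) unfolding runs_code_def by auto
  then obtain ts1 where 1: "reaches M (poly (time c1) N) (b, ts) (b + code_size c1, ts1)"
    "length ts1 = length ts" "\<forall>i<R. stack_tape (eval N c1 \<sigma> i) (ts1 ! i)"
    "\<forall>i\<ge>R. i < length ts \<longrightarrow> ts1 ! i = ts ! i"
    using Seq.IH(1)[OF _ prems(1,5) Seq.prems(4) prems(3)] by blast
  have clocks: "\<forall>d<depth c2. clock_tape N (ts1 ! (R + d))"
    using prems 1(4) by auto
  have runs2: "runs_code M R c2 (b + code_size c1) e"
    using Seq.prems(1) unfolding runs_code_def by auto
  obtain ts2 where 2: "reaches M (poly (time c2) N) (b + code_size c1, ts1) (e, ts2)"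
    "length ts2 = length ts1" "\<forall>i<R. stack_tape (eval N c2 (eval N c1 \<sigma>) i) (ts2 ! i)"
    "\<forall>i\<ge>R. i < length ts1 \<longrightarrow> ts2 ! i = ts1 ! i"
    using Seq.IH(2)[OF runs2 prems(2) _ 1(3) clocks] prems(6) 1(2) by auto
  show ?case
    using reaches_trans[OF 1(1) 2(1)] 1 2 by (intro exI[of _ ts2]) auto
next
  case (Loop c)
  define k where "k = R + depth c"
  define r where "r = Suc b + code_size c"
  obtain cl p where kt: "ts ! k = (cl, p)"
    by (cases "ts ! k")
  have k: "k < length ts" "R \<le> k" "clock_tape N (cl, p)"
    using Loop.prems kt by (auto simp: k_def)
  have body: "runs_code M R c (Suc b) b"
    using Loop.prems(1) code_size_pos[of c] unfolding runs_code_def by (auto simp: Let_def)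
  \<comment> \<open>\<open>j\<close> is the number of rounds still to come: the clock head stands
    \<open>j\<close> cells before the right blank. Clock \<open>k\<close> is exempt from the frame
    condition because it is the one that moves.\<close>
  have forward: "\<exists>ts'. reaches M (j * Suc (poly (time c) N)) (b, ts1) (b, ts') \<and> length ts' = length ts \<and>
      (\<forall>i<R. stack_tape ((eval N c ^^ j) \<tau> i) (ts' ! i)) \<and>
      (\<forall>i\<ge>R. i < length ts \<longrightarrow> i \<noteq> k \<longrightarrow> ts' ! i = ts ! i) \<and> ts' ! k = (cl, p + int N)"
    if "length ts1 = length ts" "\<forall>i<R. stack_tape (\<tau> i) (ts1 ! i)"
      "\<forall>i\<ge>R. i < length ts \<longrightarrow> i \<noteq> k \<longrightarrow> ts1 ! i = ts ! i"
      "ts1 ! k = (cl, p + int N - int j)" "j \<le> N" for j ts1 \<tau>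
    using that
  proof (induction j arbitrary: ts1 \<tau>)
    case 0
    then show ?case
      by (intro exI[of _ ts1]) (auto intro: reaches_refl)
  next
    case (Suc j)
    define ts2 where "ts2 = ts1[k := (cl, p + int N - int j)]"
    have "scanned (ts1 ! k) \<noteq> 0"
      using Suc.prems k(3) unfolding clock_tape_def
      by (auto dest!: spec[of _ "N - Suc j"] simp: algebra_simps of_nat_diff)
    moreover have "ts1[k := act (scanned (ts1 ! k), MoveRight) (ts1 ! k)] = ts2"
      using Suc.prems by (simp add: ts2_def act_scanned add_diff_eq)
    ultimately have step: "step M (b, ts1) = (Suc b, ts2)"
      using Suc.prems k
      by (intro step_code[OF Loop.prems(1)]) (auto simp: act_move Let_def k_def[symmetric])
    \<comment> \<open>Clock \<open>k\<close> is now off its first cell, but the body needs only the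
      clocks below it.\<close>
    have "\<forall>d<depth c. clock_tape N (ts2 ! (R + d))"
      using Loop.prems Suc.prems by (auto simp: ts2_def k_def nth_list_update)
    moreover have "\<forall>i<R. stack_tape (\<tau> i) (ts2 ! i)"
      using Suc.prems k by (auto simp: ts2_def)
    ultimately obtain ts3 where 3: "reaches M (poly (time c) N) (Suc b, ts2) (b, ts3)"
      "length ts3 = length ts2" "\<forall>i<R. stack_tape (eval N c \<tau> i) (ts3 ! i)"
      "\<forall>i\<ge>R. i < length ts2 \<longrightarrow> ts3 ! i = ts2 ! i"
      using Loop.IH[OF body, of ts2 \<tau>] Loop.prems Suc.prems by (auto simp: ts2_def)
    have "length ts3 = length ts" "\<forall>i\<ge>R. i < length ts \<longrightarrow> i \<noteq> k \<longrightarrow> ts3 ! i = ts ! i"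
      "ts3 ! k = (cl, p + int N - int j)" "j \<le> N"
      using 3 Suc.prems k by (auto simp: ts2_def)
    from Suc.IH[OF this(1) 3(3) this(2-)] obtain ts' where
      4: "reaches M (j * Suc (poly (time c) N)) (b, ts3) (b, ts')" "length ts' = length ts"
      "\<forall>i<R. stack_tape ((eval N c ^^ j) (eval N c \<tau>) i) (ts' ! i)"
      "\<forall>i\<ge>R. i < length ts \<longrightarrow> i \<noteq> k \<longrightarrow> ts' ! i = ts ! i" "ts' ! k = (cl, p + int N)"
      by auto
    then show ?case
      using reaches_trans[OF reaches_Suc[OF step 3(1)] 4(1)]
      by (intro exI[of _ ts']) (auto simp: funpow_swap1 ac_simps)
  qed
  obtain ts1 where 1: "reaches M (N * Suc (poly (time c) N)) (b, ts) (b, ts1)" "length ts1 = length ts"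
    "\<forall>i<R. stack_tape ((eval N c ^^ N) \<sigma> i) (ts1 ! i)"
    "\<forall>i\<ge>R. i < length ts \<longrightarrow> i \<noteq> k \<longrightarrow> ts1 ! i = ts ! i" "ts1 ! k = (cl, p + int N)"
    using forward[of ts \<sigma> N] Loop.prems kt by auto
  have turn: "step M (b, ts1) = (r, ts1[k := (cl, p + int N - 1)])"
    using 1 k
    by (intro step_code[OF Loop.prems(1)])
      (auto simp: act_move act_scanned Let_def k_def[symmetric] r_def clock_tape_def simp del: act.simps)
  \<comment> \<open>With the head at \<open>p + j - 1\<close>, \<open>j\<close> moves to the left
    reach the blank at \<open>p - 1\<close>, and one move to the right returns to
    \<open>p\<close>.\<close>
  have rewind: "reaches M (Suc j) (r, ts1[k := (cl, p + int j - 1)]) (e, ts1[k := (cl, p)])" if "j \<le> N" for j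
    using that
  proof (induction j)
    case 0
    have "step M (r, ts1[k := (cl, p - 1)]) = (e, ts1[k := (cl, p)])"
      using 1 k
      by (intro step_code[OF Loop.prems(1)])
        (auto simp: act_move act_scanned Let_def k_def[symmetric] r_def clock_tape_def simp del: act.simps)
    then show ?case
      by (auto intro: reaches_step[unfolded One_nat_def])
  next
    case (Suc j)
    have "step M (r, ts1[k := (cl, p + int j)]) = (r, ts1[k := (cl, p + int j - 1)])"
      using 1 k Suc.prems
      by (intro step_code[OF Loop.prems(1)])
        (auto simp: act_move act_scanned Let_def k_def[symmetric] r_def clock_tape_def simp del: act.simps)
    then show ?case
      using Suc reaches_Suc by auto
  qed
  have "reaches M (N * Suc (poly (time c) N) + Suc (Suc N)) (b, ts) (e, ts1[k := (cl, p)])"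
    using reaches_trans[OF 1(1) reaches_Suc[OF turn rewind]] by simp
  then have "reaches M (poly (time (Loop c)) N) (b, ts) (e, ts1[k := (cl, p)])"
    by (rule reaches_mono) (auto simp: algebra_simps)
  then show ?case
    using 1 k kt by (intro exI[of _ "ts1[k := (cl, p)]"]) (auto simp: nth_list_update)
qed

section \<open>From programs to deciding machines\<close>

definition sweep :: "nat \<Rightarrow> head_move \<Rightarrow> nat list \<Rightarrow> (nat \<times> head_move) list" where
  "sweep R m ss =
     map (\<lambda>k. if k = 0 \<or> R \<le> k then (ss ! 0, m) else (ss ! k, Stay)) [0..<length ss]"

text \<open>States \<open>0\<close> and \<open>1\<close> copy the input to all clocks and rewind.\<close>

definition machine :: "nat \<Rightarrow> nat \<Rightarrow> cmd \<Rightarrow> nat \<Rightarrow> tm" where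
  "machine R S c r =
     (let F = 2 + code_size c in
      \<lparr>num_tapes = R + depth c, num_states = F + 3, num_symbols = S, start_state = 0,
       accept_state = F + 1, reject_state = F + 2,
       transition = (\<lambda>q ss.
         if q = 0 then (if ss ! 0 \<noteq> 0 then (0, sweep R MoveRight ss) else (1, sweep R MoveLeft ss))
         else if q = 1 then
           (if ss ! 0 \<noteq> 0 then (1, sweep R MoveLeft ss) else (2, sweep R MoveRight ss))
         else if q < F then code R c 2 F q ss
         else (if ss ! r = 0 then F + 1 else F + 2, keep ss))\<rparr>)"

lemma wf_machine:
  assumes "wf_cmd R S c" "0 < R" "0 < S"
  shows "wf_tm (machine R S c r)"
proof -
  have sweep: "fst ` set (sweep R m ss) \<subseteq> {..<S}" "length (sweep R m ss) = length ss"
    if "length ss = R + depth c" "set ss \<subseteq> {..<S}" for m ss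
  proof -
    have "ss ! k \<in> {..<S}" if "k < length ss" for k
      using \<open>set ss \<subseteq> {..<S}\<close> that nth_mem by blast
    then show "fst ` set (sweep R m ss) \<subseteq> {..<S}"
      using that assms(2) by (auto simp: sweep_def)
  qed (simp add: sweep_def)
  have "fst (code R c 2 (2 + code_size c) q ss) < 2 + code_size c + 3 \<and>
      length (snd (code R c 2 (2 + code_size c) q ss)) = length ss \<and>
      fst ` set (snd (code R c 2 (2 + code_size c) q ss)) \<subseteq> {..<S}"
    if "set ss \<subseteq> {..<S}" "2 \<le> q" "q < 2 + code_size c" for q ss
    using assms that by (intro wf_code) auto
  then show ?thesis
    using assms sweep set_keep unfolding wf_tm_def machine_def Let_def by (simp add: split_beta)
qed

text \<open>Input symbols are nonzero, so copies of the input are valid clocks of length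
  \<open>N\<close>. Register 0 shares its tape with the input, and the verdict is read off the
  scanned symbol of tape \<open>r\<close>.\<close>

lemma polytime_decidable_by_cmd:
  assumes wf: "wf_cmd R (Suc s) c" and R: "r < R" and sub: "L \<subseteq> lists {1..s}"
    and eval: "\<And>w. w \<in> lists {1..s} \<Longrightarrow>
      peek (eval (length w) c ((\<lambda>_. [])(0 := w)) r) = 0 \<longleftrightarrow> w \<in> L"
  shows "polytime_decidable s L"
proof -
  define M where "M = machine R (Suc s) c r"
  define F where "F = 2 + code_size c"
  \<comment> \<open>Copying and rewinding take \<open>2 * N + 2\<close> steps and reading the
    verdict takes one, so the constant 4 leaves one step to spare.\<close>
  define P where "P = [:0, 2:] + time c + 4"
  have M [simp]: "num_tapes M = R + depth c" "start_state M = 0" "accept_state M = F + 1"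
    "reject_state M = F + 2" "num_symbols M = Suc s"
    by (auto simp: M_def machine_def F_def Let_def)
  have transition: "transition M = (\<lambda>q ss.
         if q = 0 then (if ss ! 0 \<noteq> 0 then (0, sweep R MoveRight ss) else (1, sweep R MoveLeft ss))
         else if q = 1 then
           (if ss ! 0 \<noteq> 0 then (1, sweep R MoveLeft ss) else (2, sweep R MoveRight ss))
         else if q < F then code R c 2 F q ss
         else (if ss ! r = 0 then F + 1 else F + 2, keep ss))"
    unfolding M_def machine_def Let_def F_def[symmetric] by simp
  have "state_after M w (poly P (length w)) = (if w \<in> L then accept_state M else reject_state M)"
    if w: "w \<in> lists {1..s}" for w
  proof -
    define N where "N = length w"
    define cells where "cells = (\<lambda>(j :: nat) i. if 0 \<le> i \<and> i < int j then w ! nat i else 0)"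
    \<comment> \<open>\<open>j\<close> counts the symbols already copied to the clocks, and
      \<open>p\<close> is the common head position of tape 0 and the clocks.\<close>
    define tapes where "tapes = (\<lambda>j (p :: int). map (\<lambda>k. if k = 0 then (cells N, p)
      else if R \<le> k then (cells j, p) else (\<lambda>_. 0, 0)) [0..<R + depth c])"
    have length_tapes: "length (tapes j p) = R + depth c" for j p
      by (simp add: tapes_def)
    have nonblank: "w ! i \<noteq> 0" if "i < N" for i
      using w that nth_mem[of i w] by (fastforce simp: N_def lists_eq_set)
    have blank: "cells N p = 0 \<longleftrightarrow> p < 0 \<or> int N \<le> p" for p
      using nonblank[of "nat p"] by (auto simp: cells_def)
    have init: "initial_config M w = (0, tapes 0 0)"
      using R by (auto simp: initial_config_def tapes_def cells_def word_tape_def N_def nth_Cons fun_eq_iff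
          intro!: nth_equalityI split: nat.split)
    have scanned: "map scanned (tapes j p) ! 0 = cells N p" for j p
      using R by (simp add: tapes_def)
    have sweep: "map2 act (sweep R m (map scanned (tapes j p))) (tapes j p) = tapes j' (shift m p)"
      if "(cells j)(p := cells N p) = cells j'" for j j' p m
      using R that by (intro nth_equalityI) (auto simp: tapes_def sweep_def)
    have forward: "reaches M j (0, tapes (N - j) (int (N - j))) (0, tapes N (int N))" if "j \<le> N" for j
      using that
    proof (induction j)
      case (Suc j)
      have "(cells (N - Suc j))(int (N - Suc j) := cells N (int (N - Suc j))) = cells (N - j)"
        using Suc.prems by (auto simp: cells_def fun_eq_iff)
      from sweep[OF this, where m = MoveRight]
      have step: "step M (0, tapes (N - Suc j) (int (N - Suc j))) = (0, tapes (N - j) (int (N - j)))"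
        using Suc.prems scanned blank by (simp add: step.simps transition)
      show ?case
        using Suc.prems by (intro reaches_Suc[OF step Suc.IH]) simp
    qed (simp add: reaches_refl)
    \<comment> \<open>Once the clocks hold the whole input, a sweep writes what is already there and
      merely moves the heads; this makes it usable for rewinding.\<close>
    have same: "(cells N)(p := cells N p) = cells N" for p
      by simp
    have turn: "step M (0, tapes N (int N)) = (1, tapes N (int N - 1))"
      using sweep[OF same, where m = MoveLeft] scanned blank by (simp add: step.simps transition)
    have rewind: "reaches M (Suc j) (1, tapes N (int j - 1)) (2, tapes N 0)" if "j \<le> N" for j
      using that
    proof (induction j)
      case 0
      have "step M (1, tapes N (- 1)) = (2, tapes N 0)"
        using sweep[OF same, of MoveRight "-1"] scanned blank by (simp add: step.simps transition F_def)
      then show ?case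
        by (auto intro: reaches_step[unfolded One_nat_def])
    next
      case (Suc j)
      have step: "step M (1, tapes N (int j)) = (1, tapes N (int j - 1))"
        using Suc.prems sweep[OF same, where m = MoveLeft] scanned blank
        by (simp add: step.simps transition F_def)
      show ?case
        using Suc.prems reaches_Suc[OF step Suc.IH] by simp
    qed
    have prelude: "reaches M (N + Suc (Suc N)) (initial_config M w) (2, tapes N 0)"
      using reaches_trans[OF forward[of N] reaches_Suc[OF turn rewind[of N]]] init by simp
    have runs: "runs_code M R c 2 F"
      by (auto simp: runs_code_def transition F_def)
    have regs: "\<forall>i<R. stack_tape (((\<lambda>_. [])(0 := w)) i) (tapes N 0 ! i)"
      by (auto simp: stack_tape_def tapes_def cells_def N_def)
    have clocks: "\<forall>d<depth c. clock_tape N (tapes N 0 ! (R + d))"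
      using R nonblank by (auto simp: clock_tape_def tapes_def cells_def)
    obtain ts where ts: "reaches M (poly (time c) N) (2, tapes N 0) (F, ts)"
      "length ts = R + depth c" "\<forall>i<R. stack_tape (eval N c ((\<lambda>_. [])(0 := w)) i) (ts ! i)"
      using code_correct[OF runs wf _ regs clocks] by (auto simp: length_tapes simp del: fun_upd_apply)
    define fin where "fin = (if w \<in> L then F + 1 else F + 2)"
    have "scanned (ts ! r) = 0 \<longleftrightarrow> w \<in> L"
      using stack_tape_scanned[OF ts(3)[rule_format, OF R]] eval[OF w] by (simp add: N_def)
    then have "step M (F, ts) = (fin, ts)"
      using R ts(2) by (simp add: step.simps transition F_def fin_def act_keep)
    then have "reaches M (N + Suc (Suc N) + (poly (time c) N + 1)) (initial_config M w) (fin, ts)"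
      by (intro reaches_trans[OF prelude] reaches_trans[OF ts(1)] reaches_step)
    then have "reaches M (poly P N) (initial_config M w) (fin, ts)"
      by (rule reaches_mono) (simp add: P_def)
    then obtain t where t: "t \<le> poly P N" "(step M ^^ t) (initial_config M w) = (fin, ts)"
      unfolding reaches_def by blast
    \<comment> \<open>The state is inspected after exactly \<open>poly P N\<close> steps; an earlier
      halt is padded with idle steps.\<close>
    have halt: "(step M ^^ u) (fin, ts) = (fin, ts)" for u
      by (induction u) (auto simp: step.simps fin_def)
    have "(step M ^^ poly P N) (initial_config M w) = (fin, ts)"
      using t halt[of "poly P N - t"] funpow_add[of "poly P N - t" t "step M"] by simp
    then show ?thesis
      by (simp add: state_after_def fin_def N_def)
  qed
  then have "decides_in_time M s L (poly P)"
    unfolding decides_in_time_def using wf_machine[OF wf, of r] R by (simp add: M_def[symmetric])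
  then show ?thesis
    using sub unfolding polytime_decidable_def by blast
qed

section \<open>Programming in the stack language\<close>

lemma peek_simps [simp]: "peek [] = 0" "peek (x # xs) = x"
  by (auto simp: peek_def)

text \<open>A clocked loop goes on even if nothing is left to do. When each round consumes one item
  and an empty list makes the body idle, any \<open>N\<close> that covers the items turns the loop
  into a \<open>foldl\<close>. Here \<open>S a xs\<close> is the store for accumulator
  \<open>a\<close> and remaining items \<open>xs\<close>, and \<open>X\<close> contains the items
  that the body recognises. Most loops below are evaluated by this rule.\<close>

lemma funpow_drain_invariant:
  assumes step: "\<And>a x xs. I a \<Longrightarrow> x \<in> X \<Longrightarrow> body (S a (x # xs)) = S (f a x) xs"
    and inv: "\<And>a x. I a \<Longrightarrow> x \<in> X \<Longrightarrow> I (f a x)"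
    and stop: "\<And>a. body (S a []) = S a []"
    and xs: "I a" "set xs \<subseteq> X" "length xs \<le> N"
  shows "(body ^^ N) (S a xs) = S (foldl f a xs) []"
proof -
  have "(body ^^ length xs) (S a xs) = S (foldl f a xs) []"
    using xs(1,2)
  proof (induction xs arbitrary: a)
    case (Cons x xs)
    then show ?case
      using step[of a x xs] inv[of a x] by (simp add: funpow_swap1)
  qed simp
  moreover have "(body ^^ k) (S b []) = S b []" for k b
    by (induction k) (auto simp: stop)
  ultimately show ?thesis
    using xs(3) funpow_add[of "N - length xs" "length xs" body] by simp
qed

lemmas funpow_drain = funpow_drain_invariant[where I = "\<lambda>_. True", simplified]

text \<open>Commands have no variables for symbols. Copying a symbol is possible because
  \<open>c\<close> is a function of the logic that supplies separate code for each of the four input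
  symbols. On an empty stack nothing happens, which is the idling needed in clocked loops.\<close>

definition on_sym :: "nat \<Rightarrow> (nat \<Rightarrow> cmd) \<Rightarrow> cmd" where
  "on_sym i c = Test i 1 (c 1) (Test i 2 (c 2) (Test i 3 (c 3) (Test i 4 (c 4) Skip)))"

lemma eval_on_sym [simp]:
  "eval N (on_sym i c) \<sigma> = (if peek (\<sigma> i) \<in> {1..4} then eval N (c (peek (\<sigma> i))) \<sigma> else \<sigma>)"
proof -
  have "peek (\<sigma> i) \<in> {1..4} \<longleftrightarrow> peek (\<sigma> i) \<in> {1, 2, 3, 4}"
    by auto
  then show ?thesis
    by (auto simp: on_sym_def)
qed

definition flag :: "bool \<Rightarrow> nat list" where
  "flag b = (if b then [1] else [])"

lemma flag_simps [simp]:
  "flag True = [1]" "flag False = []" "peek (flag b) = 0 \<longleftrightarrow> \<not> b" "tl (flag b) = []"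
  "flag b = [] \<longleftrightarrow> \<not> b"
  by (auto simp: flag_def)

text \<open>Raising a flag twice must not pile up entries, since a flag is reset by a single
  \<open>Pop\<close>.\<close>

definition raise :: "nat \<Rightarrow> cmd" where
  "raise m = Test m 0 (Push m 1) Skip"

definition clear :: "nat \<Rightarrow> cmd" where
  "clear i = Loop (Pop i)"

lemma eval_clear:
  assumes "length (\<sigma> i) \<le> N" shows "eval N (clear i) \<sigma> = \<sigma>(i := [])"
proof -
  have "(eval N (Pop i) ^^ N) ((\<lambda>_ xs. \<sigma>(i := xs)) () (\<sigma> i)) =
      (\<lambda>_ xs. \<sigma>(i := xs)) (foldl (\<lambda>u _. u) () (\<sigma> i)) []"
    by (rule funpow_drain[where X = UNIV]) (use assms in auto)
  then show ?thesis
    by (simp add: clear_def)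
qed

definition flush :: "nat \<Rightarrow> nat \<Rightarrow> cmd" where
  "flush i j = Loop (on_sym i (\<lambda>a. Pop i ;; Push j a))"

lemma foldl_push: "foldl (\<lambda>ys x. x # ys) ys xs = rev xs @ ys"
  by (induction xs arbitrary: ys) auto

lemma eval_flush:
  assumes "i \<noteq> j" "set (\<sigma> i) \<subseteq> {1..4}" "length (\<sigma> i) \<le> N"
  shows "eval N (flush i j) \<sigma> = \<sigma>(i := [], j := rev (\<sigma> i) @ \<sigma> j)"
proof -
  let ?S = "\<lambda>ys xs. \<sigma>(i := xs, j := ys)"
  have "(eval N (on_sym i (\<lambda>a. Pop i ;; Push j a)) ^^ N) (?S (\<sigma> j) (\<sigma> i)) =
      ?S (foldl (\<lambda>ys x. x # ys) (\<sigma> j) (\<sigma> i)) []"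
    by (rule funpow_drain[where X = "{1..4}"]) (use assms in \<open>auto simp: fun_eq_iff\<close>)
  then show ?thesis
    by (simp add: flush_def foldl_push)
qed

text \<open>\<open>g\<close> acts as a ruler: once it is empty the body idles, so \<open>e\<close>
  advances by exactly \<open>length g\<close> symbols and what follows in \<open>e\<close> stays in
  place.\<close>

definition walk :: "(nat \<Rightarrow> nat \<Rightarrow> bool) \<Rightarrow> nat \<Rightarrow> nat \<Rightarrow> nat \<Rightarrow> nat \<Rightarrow> nat \<Rightarrow> cmd" where
  "walk R g g' e e' m = Loop (on_sym g (\<lambda>a. on_sym e (\<lambda>b.
     (if R a b then Skip else raise m) ;; Pop g ;; Push g' a ;; Pop e ;; Push e' b)))"

lemma eval_walk:
  assumes "distinct [g, g', e, e', m]" "\<sigma> e = us @ rest" "length us = length (\<sigma> g)"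
    "set (\<sigma> g) \<subseteq> {1..4}" "set us \<subseteq> {1..4}" "length us \<le> N" "\<sigma> m = flag b"
  shows "eval N (walk R g g' e e' m) \<sigma> =
    \<sigma>(m := flag (b \<or> \<not> list_all2 R (\<sigma> g) us),
      g := [], g' := rev (\<sigma> g) @ \<sigma> g', e := rest, e' := rev us @ \<sigma> e')"
proof -
  have ne: "g \<noteq> g'" "g \<noteq> e" "g \<noteq> e'" "g \<noteq> m" "g' \<noteq> g" "g' \<noteq> e" "g' \<noteq> e'" "g' \<noteq> m" "e \<noteq> g" "e \<noteq> g'" "e \<noteq> e'" "e \<noteq> m" "e' \<noteq> g" "e' \<noteq> g'" "e' \<noteq> e" "e' \<noteq> m" "m \<noteq> g" "m \<noteq> g'" "m \<noteq> e" "m \<noteq> e'"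
    using assms(1) by auto
  \<comment> \<open>Both stacks are read off one list of pairs, so that a round consumes a single
    item in the sense of \<open>funpow_drain\<close>.\<close>
  let ?S = "\<lambda>(gs, es, b) ps. \<sigma>(m := flag b, g := map fst ps, g' := gs, e := map snd ps @ rest, e' := es)"
  let ?f = "\<lambda>(gs, es, b) (x, y). (x # gs, y # es, b \<or> \<not> R x y)"
  let ?c = "on_sym g (\<lambda>a. on_sym e (\<lambda>b.
     (if R a b then Skip else raise m) ;; Pop g ;; Push g' a ;; Pop e ;; Push e' b))"
  have "(eval N ?c ^^ N) (?S (\<sigma> g', \<sigma> e', b) (zip (\<sigma> g) us)) =
      ?S (foldl ?f (\<sigma> g', \<sigma> e', b) (zip (\<sigma> g) us)) []"
  proof (rule funpow_drain[where X = "{1..4} \<times> {1..4}"])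
    show "set (zip (\<sigma> g) us) \<subseteq> {1..4} \<times> {1..4}"
      using assms(4,5) by (auto dest: set_zip_leftD set_zip_rightD)
  next
    fix a :: "nat list \<times> nat list \<times> bool" and p :: "nat \<times> nat" and ps
    assume "p \<in> {1..4} \<times> {1..4}"
    then show "eval N ?c (?S a (p # ps)) = ?S (?f a p) ps"
      by (cases a; cases p) (simp add: raise_def flag_def ne)
  qed (use assms(6) ne in \<open>auto split: prod.splits\<close>)
  moreover have "?S (\<sigma> g', \<sigma> e', b) (zip (\<sigma> g) us) = \<sigma>"
    using assms by (auto simp: fun_eq_iff)
  moreover have "foldl ?f (gs, es, b) (zip vs us) = (rev vs @ gs, rev us @ es, b \<or> \<not> list_all2 R vs us)"
    if "length vs = length us" for gs es vs b
    using that by (induction vs us arbitrary: gs es b rule: list_induct2) auto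
  ultimately show ?thesis
    using assms(3) by (simp add: walk_def)
qed

text \<open>Also with \<open>m\<close> raised, when the cube is only copied, both stacks have to be
  traversed: the position in \<open>e\<close> afterwards must not depend on the outcome of the
  match.\<close>

definition join :: "nat \<Rightarrow> nat \<Rightarrow> nat \<Rightarrow> nat \<Rightarrow> nat \<Rightarrow> cmd" where
  "join g g' e e' m = Loop (on_sym g (\<lambda>a. on_sym e (\<lambda>b.
     Pop g ;; (if a = b then Push g' a else Test m 0 (Push g' 3) (Push g' a)) ;;
     Pop e ;; Push e' b)))"

definition vjoin :: "nat list \<Rightarrow> nat list \<Rightarrow> nat list" where
  "vjoin = map2 (\<lambda>a b. if a = b then a else 3)"

lemma eval_join:
  assumes "distinct [g, g', e, e', m]" "\<sigma> e = us @ rest" "length us = length (\<sigma> g)"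
    "set (\<sigma> g) \<subseteq> {1..4}" "set us \<subseteq> {1..4}" "length us \<le> N" "\<sigma> m = flag b"
  shows "eval N (join g g' e e' m) \<sigma> =
    \<sigma>(g := [], g' := rev (if b then \<sigma> g else vjoin (\<sigma> g) us) @ \<sigma> g', e := rest, e' := rev us @ \<sigma> e')"
proof -
  have ne: "g \<noteq> g'" "g \<noteq> e" "g \<noteq> e'" "g \<noteq> m" "g' \<noteq> g" "g' \<noteq> e" "g' \<noteq> e'" "g' \<noteq> m" "e \<noteq> g" "e \<noteq> g'" "e \<noteq> e'" "e \<noteq> m" "e' \<noteq> g" "e' \<noteq> g'" "e' \<noteq> e" "e' \<noteq> m" "m \<noteq> g" "m \<noteq> g'" "m \<noteq> e" "m \<noteq> e'"
    using assms(1) by auto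
  let ?S = "\<lambda>(gs, es) ps. \<sigma>(g := map fst ps, g' := gs, e := map snd ps @ rest, e' := es)"
  let ?f = "\<lambda>(gs, es) (x, y). ((if b \<or> x = y then x else 3) # gs, y # es)"
  let ?c = "on_sym g (\<lambda>a. on_sym e (\<lambda>b.
     Pop g ;; (if a = b then Push g' a else Test m 0 (Push g' 3) (Push g' a)) ;;
     Pop e ;; Push e' b))"
  have "(eval N ?c ^^ N) (?S (\<sigma> g', \<sigma> e') (zip (\<sigma> g) us)) =
      ?S (foldl ?f (\<sigma> g', \<sigma> e') (zip (\<sigma> g) us)) []"
  proof (rule funpow_drain[where X = "{1..4} \<times> {1..4}"])
    show "set (zip (\<sigma> g) us) \<subseteq> {1..4} \<times> {1..4}"
      using assms(4,5) by (auto dest: set_zip_leftD set_zip_rightD)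
  next
    fix a :: "nat list \<times> nat list" and p :: "nat \<times> nat" and ps
    assume "p \<in> {1..4} \<times> {1..4}"
    then show "eval N ?c (?S a (p # ps)) = ?S (?f a p) ps"
      using assms(7) by (cases a; cases p) (simp add: ne)
  qed (use assms(6) ne in \<open>auto split: prod.splits\<close>)
  moreover have "?S (\<sigma> g', \<sigma> e') (zip (\<sigma> g) us) = \<sigma>"
    using assms by (auto simp: fun_eq_iff)
  moreover have "foldl ?f (gs, es) (zip vs us) = (rev (if b then vs else vjoin vs us) @ gs, rev us @ es)"
    if "length vs = length us" for gs es vs
    using that by (induction vs us arbitrary: gs es rule: list_induct2) (auto simp: vjoin_def)
  ultimately show ?thesis
    using assms(3) by (simp add: join_def)
qed

section \<open>The decision procedures\<close>

text \<open>Register \<open>rI\<close> holds the input, \<open>rE\<close> the edges, \<open>rF\<close> the edges still to be examined as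
  sources, \<open>rG\<close> and \<open>rH\<close> the current and the given cube; a primed register keeps, reversed, what has
  been read off its unprimed partner. \<open>rM\<close>, \<open>rY\<close>, \<open>rZ\<close>, \<open>rK\<close> flag mismatches, \<open>rX\<close> and \<open>rC\<close> are
  unary counters, \<open>rD\<close> is scratch space, and a nonempty \<open>rB\<close> means rejection. Number \<open>1\<close>
  is skipped because the simplifier turns it into \<open>Suc 0\<close>.\<close>

abbreviation (input) "rI \<equiv> 0 :: nat"
abbreviation (input) "rE \<equiv> 2 :: nat"
abbreviation (input) "rE' \<equiv> 3 :: nat"
abbreviation (input) "rF \<equiv> 4 :: nat"
abbreviation (input) "rG \<equiv> 5 :: nat"
abbreviation (input) "rG' \<equiv> 6 :: nat"
abbreviation (input) "rH \<equiv> 7 :: nat"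
abbreviation (input) "rH' \<equiv> 8 :: nat"
abbreviation (input) "rM \<equiv> 9 :: nat"
abbreviation (input) "rX \<equiv> 10 :: nat"
abbreviation (input) "rY \<equiv> 11 :: nat"
abbreviation (input) "rZ \<equiv> 12 :: nat"
abbreviation (input) "rK \<equiv> 13 :: nat"
abbreviation (input) "rD \<equiv> 14 :: nat"
abbreviation (input) "rC \<equiv> 15 :: nat"
abbreviation (input) "rB \<equiv> 16 :: nat"

section \<open>Words for vectors, cubes and edge lists\<close>

definition vec :: "nat \<Rightarrow> nat list \<Rightarrow> bool" where
  "vec n x \<longleftrightarrow> length x = n \<and> set x \<subseteq> {1, 2}"

definition cube :: "nat \<Rightarrow> nat list \<Rightarrow> bool" where
  "cube n g \<longleftrightarrow> length g = n \<and> set g \<subseteq> {1, 2, 3}"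

definition vmatch :: "nat list \<Rightarrow> nat list \<Rightarrow> bool" where
  "vmatch = list_all2 (\<lambda>a b. a = 3 \<or> a = b)"

definition words :: "(nat list \<times> nat list) list \<Rightarrow> nat list" where
  "words es = concat (map (\<lambda>(x, y). x @ 4 # y @ [4]) es)"

text \<open>The two bounds make \<open>N\<close> rounds sufficient for a loop over the entries of a
  vector and for a loop over the edge list.\<close>

definition edges_ok :: "nat \<Rightarrow> nat \<Rightarrow> (nat list \<times> nat list) list \<Rightarrow> bool" where
  "edges_ok N n es \<longleftrightarrow> set es \<subseteq> Collect (vec n) \<times> Collect (vec n) \<and> n \<le> N \<and> length (words es) \<le> N"

lemma words_simps [simp]: "words [] = []" "words ((x, y) # es) = x @ 4 # y @ 4 # words es"
  by (auto simp: words_def)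

text \<open>Each edge contributes two terminators, so this holds even in dimension 0, where the
  vectors are empty.\<close>

lemma length_words: "length es \<le> length (words es)"
  by (induction es) auto

lemma vecD: "vec n x \<Longrightarrow> length x = n \<and> set x \<subseteq> {1..4}"
  by (auto simp: vec_def)

lemma set_words: "set es \<subseteq> Collect (vec n) \<times> Collect (vec n) \<Longrightarrow> set (words es) \<subseteq> {1..4}"
  by (induction es) (auto dest!: vecD simp: subset_eq)

lemma cubeD: "cube n x \<Longrightarrow> length x = n \<and> set x \<subseteq> {1..4}"
  by (auto simp: cube_def)

lemma vec_imp_cube: "vec n x \<Longrightarrow> cube n x"
  by (auto simp: vec_def cube_def)

lemma cube_vjoin: "cube n g \<Longrightarrow> vec n y \<Longrightarrow> cube n (vjoin g y)"
  by (fastforce simp: cube_def vec_def vjoin_def dest: set_zip_leftD)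

section \<open>Passes over the edge list\<close>

definition edge_loop :: "cmd \<Rightarrow> cmd" where
  "edge_loop c =
     Loop (Test rE 0 Skip
       (walk (\<lambda>a b. a = 3 \<or> a = b) rG rG' rE rE' rM ;; Pop rE ;; Push rE' 4 ;; flush rG' rG ;;
        c ;; Pop rE ;; Push rE' 4 ;; Pop rM)) ;;
     flush rE' rE"

text \<open>\<open>T a\<close> is the store as a function of an abstract accumulator that
  \<open>f\<close> updates edge by edge; it covers both a pass that changes the cube and a pass that
  only counts. The body \<open>c\<close> starts in front of the target, has to stop at its
  terminator, and learns from \<open>rM\<close> whether the source missed the cube.\<close>

lemma eval_edge_loop:
  assumes es: "edges_ok N n es"
    and T: "\<And>a. I a \<Longrightarrow> cube n (T a rG)" "\<And>a. T a rG' = []" "\<And>a. T a rM = []" "\<And>a. T a rE' = []"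
    and act: "\<And>a x y r e. I a \<Longrightarrow> vec n x \<Longrightarrow> vec n y \<Longrightarrow>
      eval N c ((T a)(rE := y @ 4 # r, rE' := e, rM := flag (\<not> vmatch (T a rG) x))) =
      (T (f a (x, y)))(rE := 4 # r, rE' := rev y @ e, rM := flag (\<not> vmatch (T a rG) x))"
    and inv: "\<And>a x y. I a \<Longrightarrow> vec n x \<Longrightarrow> vec n y \<Longrightarrow> I (f a (x, y))"
    and a: "I a"
  shows "eval N (edge_loop c) ((T a)(rE := words es)) = (T (foldl f a es))(rE := words es)"
proof -
  let ?S = "\<lambda>(a, e) es. (T a)(rE := words es, rE' := e)"
  let ?f = "\<lambda>(a, e) (x, y). (f a (x, y), rev (x @ 4 # y @ [4]) @ e)"
  define body where "body = Test rE 0 Skip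
       (walk (\<lambda>a b. a = 3 \<or> a = b) rG rG' rE rE' rM ;; Pop rE ;; Push rE' 4 ;; flush rG' rG ;;
        c ;; Pop rE ;; Push rE' 4 ;; Pop rM)"
  have body: "eval N body ((T a)(rE := words ((x, y) # es), rE' := e)) =
      (T (f a (x, y)))(rE := words es, rE' := rev (x @ 4 # y @ [4]) @ e)"
    if "I a" "vec n x" "vec n y" for a x y es e
  proof -
    define g where "g = T a rG"
    let ?m = "flag (\<not> vmatch g x)"
    note len = cubeD[OF T(1)[OF \<open>I a\<close>]] vecD[OF \<open>vec n x\<close>]
    have N: "n \<le> N"
      using assms by (simp add: edges_ok_def)
    let ?s = "(T a)(rE := words ((x, y) # es), rE' := e)"
    have walk: "eval N (walk (\<lambda>a b. a = 3 \<or> a = b) rG rG' rE rE' rM) ?s =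
      ?s(rM := ?m, rG := [], rG' := rev g, rE := 4 # y @ 4 # words es, rE' := rev x @ e)"
      by (subst eval_walk[where us = x and rest = "4 # y @ 4 # words es" and b = False])
        (use len N T in \<open>auto simp: g_def vmatch_def\<close>)
    let ?s2 = "(T a)(rG := [], rG' := rev g, rE := y @ 4 # words es, rE' := 4 # rev x @ e, rM := ?m)"
    have flush: "eval N (flush rG' rG) ?s2 =
        (T a)(rE := y @ 4 # words es, rE' := 4 # rev x @ e, rM := ?m)"
      by (subst eval_flush) (use len N T in \<open>auto simp: g_def fun_eq_iff\<close>)
    have nonempty: "peek (words ((x, y) # es)) \<noteq> 0"
      using that(2) by (cases x) (auto simp: vec_def)
    have "eval N (walk (\<lambda>a b. a = 3 \<or> a = b) rG rG' rE rE' rM ;; Pop rE ;; Push rE' 4) ?s = ?s2"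
      unfolding eval.simps(5) walk by (auto simp: fun_eq_iff)
    then have "eval N body ?s = eval N (Pop rE ;; Push rE' 4 ;; Pop rM) (eval N c (eval N (flush rG' rG) ?s2))"
      using nonempty by (simp add: body_def)
    also have "\<dots> = eval N (Pop rE ;; Push rE' 4 ;; Pop rM)
        ((T (f a (x, y)))(rE := 4 # words es, rE' := rev y @ 4 # rev x @ e, rM := ?m))"
      unfolding flush using act[OF that, of "words es" "4 # rev x @ e"] by (simp add: g_def)
    also have "\<dots> = (T (f a (x, y)))(rE := words es, rE' := rev (x @ 4 # y @ [4]) @ e)"
      using T by (auto simp: fun_eq_iff)
    finally show ?thesis .
  qed
  have "(eval N body ^^ N) (?S (a, []) es) = ?S (foldl ?f (a, []) es) []"
  proof (rule funpow_drain_invariant[where X = "Collect (vec n) \<times> Collect (vec n)" and I = "I \<circ> fst"])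
    show "eval N body (?S b []) = ?S b []" for b
      by (cases b) (simp add: body_def)
    show "eval N body (?S b (p # ps)) = ?S (?f b p) ps"
      if "(I \<circ> fst) b" "p \<in> Collect (vec n) \<times> Collect (vec n)" for b p ps
      using that body[of "fst b" "fst p" "snd p"] by (cases b; cases p) simp
  qed (use inv a es length_words[of es] in \<open>auto simp: edges_ok_def\<close>)
  moreover have "foldl ?f (a, e) es = (foldl f a es, rev (words es) @ e)" for e
    by (induction es arbitrary: a e) auto
  moreover have "?S (a, []) es = (T a)(rE := words es)"
    using T(4) by (auto simp: fun_eq_iff)
  ultimately have "eval N (edge_loop c) ((T a)(rE := words es)) =
      eval N (flush rE' rE) ((T (foldl f a es))(rE := [], rE' := rev (words es)))"
    by (simp add: edge_loop_def body_def[symmetric])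
  also have "\<dots> = (T (foldl f a es))(rE := words es)"
    using es set_words[of es n] T(4) by (subst eval_flush) (auto simp: edges_ok_def fun_eq_iff)
  finally show ?thesis .
qed

text \<open>An edge is tested against the cube as enlarged by the edges before it, which suits an
  update in place. The order of the edges influences the intermediate cubes but not the closure
  finally reached.\<close>

definition sweep_join :: "(nat list \<times> nat list) list \<Rightarrow> nat list \<Rightarrow> nat list" where
  "sweep_join es g = foldl (\<lambda>g (x, y). if vmatch g x then vjoin g y else g) g es"

definition join_pass :: cmd where
  "join_pass = edge_loop (join rG rG' rE rE' rM ;; flush rG' rG)"

lemma cube_sweep_join:
  assumes "edges_ok N n es" "cube n g" shows "cube n (sweep_join es g)"
proof -
  have "set es \<subseteq> Collect (vec n) \<times> Collect (vec n)"
    using assms by (simp add: edges_ok_def)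
  then show ?thesis
    using assms(2) unfolding sweep_join_def
    by (induction es arbitrary: g) (auto simp: cube_vjoin)
qed

lemma eval_join_pass:
  assumes es: "edges_ok N n es" and G: "cube n (\<sigma> rG)"
    and \<sigma>: "\<sigma> rE = words es" "\<sigma> rE' = []" "\<sigma> rG' = []" "\<sigma> rM = []"
  shows "eval N join_pass \<sigma> = \<sigma>(rG := sweep_join es (\<sigma> rG))"
proof -
  have n: "n \<le> N"
    using es by (simp add: edges_ok_def)
  have "eval N join_pass ((\<sigma>(rG := \<sigma> rG))(rE := words es)) =
      (\<sigma>(rG := sweep_join es (\<sigma> rG)))(rE := words es)"
    unfolding join_pass_def sweep_join_def
  proof (rule eval_edge_loop[where T = "\<lambda>g. \<sigma>(rG := g)" and I = "cube n", OF es])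
    fix g x y r e
    assume g: "cube n g" and x: "vec n x" and y: "vec n y"
    let ?m = "flag (\<not> vmatch g x)"
    let ?s = "\<sigma>(rG := g, rE := y @ 4 # r, rE' := e, rM := ?m)"
    let ?g = "if vmatch g x then vjoin g y else g"
    have "eval N (join rG rG' rE rE' rM) ?s =
        ?s(rG := [], rG' := rev ?g, rE := 4 # r, rE' := rev y @ e)"
      by (subst eval_join[where us = y and rest = "4 # r" and b = "\<not> vmatch g x"])
        (use cubeD[OF g] vecD[OF y] \<sigma> n in auto)
    moreover have "eval N (flush rG' rG) (?s(rG := [], rG' := rev ?g, rE := 4 # r, rE' := rev y @ e)) =
        \<sigma>(rG := ?g, rE := 4 # r, rE' := rev y @ e, rM := ?m)"
      by (subst eval_flush) (use cubeD[OF g] cubeD[OF cube_vjoin[OF g y]] n \<sigma> in \<open>auto simp: fun_eq_iff\<close>)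
    ultimately show "eval N (join rG rG' rE rE' rM ;; flush rG' rG)
        (\<sigma>(rG := g, rE := y @ 4 # r, rE' := e, rM := flag (\<not> vmatch ((\<sigma>(rG := g)) rG) x))) =
      \<sigma>(rG := case (x, y) of (x, y) \<Rightarrow> if vmatch g x then vjoin g y else g,
        rE := 4 # r, rE' := rev y @ e, rM := flag (\<not> vmatch ((\<sigma>(rG := g)) rG) x))"
      by simp
  qed (use \<sigma> G cube_vjoin in auto)
  moreover have "\<sigma>(rG := g, rE := words es) = \<sigma>(rG := g)" "\<sigma>(rE := words es) = \<sigma>" for g
    using \<sigma> by (auto simp: fun_eq_iff)
  ultimately show ?thesis
    by simp
qed

lemma eval_join_passes:
  assumes es: "edges_ok N n es" and G: "cube n (\<sigma> rG)"
    and \<sigma>: "\<sigma> rE = words es" "\<sigma> rE' = []" "\<sigma> rG' = []" "\<sigma> rM = []"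
  shows "eval N (Loop join_pass) \<sigma> = \<sigma>(rG := (sweep_join es ^^ N) (\<sigma> rG))"
proof -
  have cube: "cube n ((sweep_join es ^^ k) (\<sigma> rG))" for k
    using G cube_sweep_join[OF es] by (induction k) auto
  have pass: "eval N join_pass (\<sigma>(rG := g)) = \<sigma>(rG := sweep_join es g)" if "cube n g" for g
    using eval_join_pass[OF es, of "\<sigma>(rG := g)"] that \<sigma> by simp
  have "(eval N join_pass ^^ k) \<sigma> = \<sigma>(rG := (sweep_join es ^^ k) (\<sigma> rG))" for k
    by (induction k) (simp_all add: pass[OF cube] del: fun_upd_apply)
  then show ?thesis
    by simp
qed

text \<open>With a configuration in \<open>rG\<close>, matching is equality, and the counter tells
  how often that configuration occurs as a source. The \<open>walk\<close> with the constantly true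
  relation serves to get past the target, with \<open>rG\<close> as the ruler.\<close>

definition count_pass :: cmd where
  "count_pass = edge_loop
     (walk (\<lambda>_ _. True) rG rG' rE rE' rK ;; flush rG' rG ;; Test rM 0 (Push rX 1) Skip)"

lemma eval_count_pass:
  assumes es: "edges_ok N n es" and G: "cube n (\<sigma> rG)"
    and \<sigma>: "\<sigma> rE = words es" "\<sigma> rE' = []" "\<sigma> rG' = []" "\<sigma> rM = []" "\<sigma> rK = []" "\<sigma> rX = []"
  shows "eval N count_pass \<sigma> = \<sigma>(rX := replicate (length (filter (vmatch (\<sigma> rG) \<circ> fst) es)) 1)"
proof -
  have n: "n \<le> N"
    using es by (simp add: edges_ok_def)
  define g where "g = \<sigma> rG"
  let ?f = "\<lambda>k (x, y). if vmatch g x then Suc k else k"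
  have "eval N count_pass ((\<sigma>(rX := replicate 0 1))(rE := words es)) =
      (\<sigma>(rX := replicate (foldl ?f 0 es) 1))(rE := words es)"
    unfolding count_pass_def
  proof (rule eval_edge_loop[where T = "\<lambda>k. \<sigma>(rX := replicate k 1)" and I = "\<lambda>_. True", OF es])
    fix k :: nat and x y r e
    assume x: "vec n x" and y: "vec n y"
    let ?m = "flag (\<not> vmatch g x)"
    let ?s = "\<sigma>(rX := replicate k 1, rE := y @ 4 # r, rE' := e, rM := ?m)"
    have all: "list_all2 (\<lambda>_ _. True) g y"
      using cubeD[OF G] vecD[OF y] by (simp add: list_all2_conv_all_nth g_def)
    have 1: "eval N (walk (\<lambda>_ _. True) rG rG' rE rE' rK) ?s =
        ?s(rK := flag False, rG := [], rG' := rev g, rE := 4 # r, rE' := rev y @ e)"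
      by (subst eval_walk[where us = y and rest = "4 # r" and b = False])
        (use cubeD[OF G] vecD[OF y] \<sigma> n all in \<open>auto simp: g_def\<close>)
    have 2: "eval N (flush rG' rG) (?s(rK := flag False, rG := [], rG' := rev g, rE := 4 # r, rE' := rev y @ e)) =
        \<sigma>(rX := replicate k 1, rE := 4 # r, rE' := rev y @ e, rM := ?m)"
      by (subst eval_flush) (use cubeD[OF G] n \<sigma> in \<open>auto simp: fun_eq_iff g_def\<close>)
    have g: "(\<sigma>(rX := replicate k 1)) rG = g"
      by (simp add: g_def)
    show "eval N (walk (\<lambda>_ _. True) rG rG' rE rE' rK ;; flush rG' rG ;; Test rM 0 (Push rX 1) Skip)
        (\<sigma>(rX := replicate k 1, rE := y @ 4 # r, rE' := e,
          rM := flag (\<not> vmatch ((\<sigma>(rX := replicate k 1)) rG) x))) =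
      \<sigma>(rX := replicate (?f k (x, y)) 1,
        rE := 4 # r, rE' := rev y @ e, rM := flag (\<not> vmatch ((\<sigma>(rX := replicate k 1)) rG) x))"
      unfolding eval.simps(5) g 1 2 by (auto simp: fun_eq_iff)
  qed (use \<sigma> G in auto)
  moreover have "\<sigma>(rX := g, rE := words es) = \<sigma>(rX := g)" "\<sigma>(rX := []) = \<sigma>" "\<sigma>(rE := words es) = \<sigma>" for g
    using \<sigma> by (auto simp: fun_eq_iff)
  moreover have "foldl ?f k es = k + length (filter (vmatch g \<circ> fst) es)" for k
    by (induction es arbitrary: k) auto
  ultimately show ?thesis
    by (simp add: g_def)
qed

text \<open>The first \<open>walk\<close> compares the source with \<open>rH\<close> and, by taking
  \<open>rG'\<close> as its destination, also brings the source into \<open>rG\<close>, where it is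
  a cube without stars. The counting pass includes the edge at hand, hence the
  \<open>Pop rX\<close>: whatever remains is a second edge with this source.\<close>

definition source_step :: "cmd \<Rightarrow> cmd" where
  "source_step check =
     walk (\<lambda>a b. a = 3 \<or> a = b) rH rH' rF rG' rY ;; Pop rF ;; flush rH' rH ;; flush rG' rG ;;
     count_pass ;; Pop rX ;; Test rX 0 Skip (raise rB) ;; clear rX ;;
     walk (\<lambda>a b. a = 3 \<or> a = b) rH rH' rF rD rZ ;; Pop rF ;; flush rH' rH ;;
     check ;; Pop rY ;; Pop rZ"

definition idle :: "store \<Rightarrow> bool" where
  "idle \<sigma> \<longleftrightarrow> \<sigma> rE' = [] \<and> \<sigma> rG' = [] \<and> \<sigma> rH' = [] \<and> \<sigma> rM = [] \<and> \<sigma> rX = [] \<and> \<sigma> rK = []"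

definition check_spec ::
    "nat \<Rightarrow> nat \<Rightarrow> (nat list \<times> nat list) list \<Rightarrow> nat list \<Rightarrow> cmd \<Rightarrow> (nat list \<Rightarrow> nat list \<Rightarrow> bool) \<Rightarrow> bool" where
  "check_spec N n es h check bad \<longleftrightarrow> (\<forall>\<sigma> x y b. idle \<sigma> \<longrightarrow> vec n x \<longrightarrow> vec n y \<longrightarrow>
     \<sigma> rE = words es \<longrightarrow> \<sigma> rH = h \<longrightarrow> \<sigma> rG = x \<longrightarrow> \<sigma> rD = rev y \<longrightarrow> \<sigma> rB = flag b \<longrightarrow>
     \<sigma> rY = flag (\<not> vmatch h x) \<longrightarrow> \<sigma> rZ = flag (\<not> vmatch h y) \<longrightarrow>
     eval N check \<sigma> = \<sigma>(rG := [], rD := [], rB := flag (b \<or> bad x y)))"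

lemma eval_source_step:
  assumes es: "edges_ok N n es" and h: "cube n h" and x: "vec n x" and y: "vec n y"
    and check: "check_spec N n es h check bad"
    and \<sigma>: "idle \<sigma>" "\<sigma> rE = words es" "\<sigma> rH = h" "\<sigma> rF = x @ 4 # y @ 4 # r" "\<sigma> rB = flag b"
      "\<sigma> rG = []" "\<sigma> rD = []" "\<sigma> rY = []" "\<sigma> rZ = []"
  shows "eval N (source_step check) \<sigma> =
    \<sigma>(rF := r, rB := flag (b \<or> length (filter (vmatch x \<circ> fst) es) > 1 \<or> bad x y))"
proof -
  have n: "n \<le> N" "length es \<le> N"
    using es length_words[of es] by (auto simp: edges_ok_def)
  note \<sigma>' = \<sigma>(1)[unfolded idle_def] \<sigma>(2-)
  note len = cubeD[OF h] vecD[OF x] vecD[OF y]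
  define k where "k = length (filter (vmatch x \<circ> fst) es)"
  have k: "k \<le> N"
    using n(2) by (auto simp: k_def intro: le_trans[OF length_filter_le])
  let ?Y = "flag (\<not> vmatch h x)" and ?Z = "flag (\<not> vmatch h y)"
  let ?s1 = "\<sigma>(rY := ?Y, rH := [], rH' := rev h, rF := 4 # y @ 4 # r, rG' := rev x)"
  let ?s2 = "\<sigma>(rY := ?Y, rF := y @ 4 # r, rG := x)"
  have 1: "eval N (walk (\<lambda>a b. a = 3 \<or> a = b) rH rH' rF rG' rY) \<sigma> = ?s1"
    by (subst eval_walk[where us = x and rest = "4 # y @ 4 # r" and b = False])
      (use len \<sigma>' n in \<open>auto simp: vmatch_def\<close>)
  have 2: "eval N (flush rH' rH) (?s1(rF := y @ 4 # r)) =
      \<sigma>(rY := ?Y, rF := y @ 4 # r, rG' := rev x)"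
    by (subst eval_flush) (use len \<sigma>' n in \<open>auto simp: fun_eq_iff\<close>)
  have 3: "eval N (flush rG' rG) (\<sigma>(rY := ?Y, rF := y @ 4 # r, rG' := rev x)) = ?s2"
    by (subst eval_flush) (use len \<sigma>' n in \<open>auto simp: fun_eq_iff\<close>)
  have 4: "eval N count_pass ?s2 = ?s2(rX := replicate k 1)"
    using eval_count_pass[OF es, of ?s2] vec_imp_cube[OF x] \<sigma>' by (simp add: k_def)
  let ?s4 = "?s2(rX := replicate (k - 1) 1, rB := flag (b \<or> k > 1))"
  have 5: "eval N (Pop rX ;; Test rX 0 Skip (raise rB)) (?s2(rX := replicate k 1)) = ?s4"
    using \<sigma>' by (cases k; cases "k - 1") (auto simp: fun_eq_iff raise_def flag_def)
  have 6: "eval N (clear rX) ?s4 = ?s2(rB := flag (b \<or> k > 1))"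
    by (subst eval_clear) (use k \<sigma>' in \<open>auto simp: fun_eq_iff\<close>)
  let ?s6 = "?s2(rB := flag (b \<or> k > 1), rZ := ?Z, rH := [], rH' := rev h, rF := 4 # r, rD := rev y)"
  have 7: "eval N (walk (\<lambda>a b. a = 3 \<or> a = b) rH rH' rF rD rZ) (?s2(rB := flag (b \<or> k > 1))) = ?s6"
    by (subst eval_walk[where us = y and rest = "4 # r" and b = False])
      (use len \<sigma>' n in \<open>auto simp: vmatch_def\<close>)
  let ?s7 = "?s2(rB := flag (b \<or> k > 1), rZ := ?Z, rF := r, rD := rev y)"
  have 8: "eval N (flush rH' rH) (?s6(rF := r)) = ?s7"
    by (subst eval_flush) (use len \<sigma>' n in \<open>auto simp: fun_eq_iff\<close>)
  have 9: "eval N check ?s7 = ?s7(rG := [], rD := [], rB := flag ((b \<or> k > 1) \<or> bad x y))"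
    using \<sigma>' x y by (intro check[unfolded check_spec_def, rule_format]) (auto simp: idle_def)
  have pop: "eval N (Pop rF) ?s1 = ?s1(rF := y @ 4 # r)" "eval N (Pop rF) ?s6 = ?s6(rF := r)"
    by simp_all
  have "eval N (source_step check) \<sigma> =
      eval N (Pop rY ;; Pop rZ) (?s7(rG := [], rD := [], rB := flag ((b \<or> k > 1) \<or> bad x y)))"
    unfolding source_step_def eval.simps(5) 1 pop 2 3 4 5[unfolded eval.simps(5)] 6 7 8 9 ..
  also have "\<dots> = \<sigma>(rF := r, rB := flag (b \<or> k > 1 \<or> bad x y))"
    using \<sigma>' by (auto simp: fun_eq_iff)
  finally show ?thesis
    by (simp add: k_def)
qed

section \<open>Testing that the number of edges is \<open>2 ^ n\<close>\<close>

definition halve :: cmd where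
  "halve = Loop (Test rC 0 Skip (Pop rC ;; Test rC 0 (raise rB) Skip ;; Pop rC ;; Push rD 1)) ;;
     flush rD rC"

lemma eval_halve:
  assumes \<sigma>: "\<sigma> rC = replicate k 1" "\<sigma> rD = []" "\<sigma> rB = flag b" and k: "k \<le> N"
  shows "eval N halve \<sigma> = \<sigma>(rC := replicate (Suc k div 2) 1, rB := flag (b \<or> odd k))"
proof -
  define body where
    "body = Test rC 0 Skip (Pop rC ;; Test rC 0 (raise rB) Skip ;; Pop rC ;; Push rD 1)"
  let ?S = "\<lambda>k d b. \<sigma>(rC := replicate k 1, rD := replicate d 1, rB := flag b)"
  have stop: "(eval N body ^^ m) (?S 0 d b) = ?S 0 d b" for m d b
    by (induction m) (auto simp: body_def)
  have "(eval N body ^^ m) (?S k d b) = ?S 0 (d + Suc k div 2) (b \<or> odd k)" if "k \<le> m" for m d b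
    using that
  proof (induction k arbitrary: m d rule: induct_nat_012)
    case 1
    then obtain m' where m: "m = Suc m'"
      by (cases m) auto
    have "eval N body (?S 1 d b) = ?S 0 (Suc d) True"
      by (auto simp: body_def raise_def flag_def fun_eq_iff)
    then have "(eval N body ^^ m) (?S 1 d b) = (eval N body ^^ m') (?S 0 (Suc d) True)"
      by (simp only: m funpow_Suc_right o_apply)
    also have "\<dots> = ?S 0 (Suc d) True"
      by (rule stop)
    finally show ?case
      by (simp del: fun_upd_apply)
  next
    case (ge2 k)
    then obtain m' where m: "m = Suc m'"
      by (cases m) auto
    have "eval N body (?S (Suc (Suc k)) d b) = ?S k (Suc d) b"
      by (auto simp: body_def fun_eq_iff)
    then have "(eval N body ^^ m) (?S (Suc (Suc k)) d b) = (eval N body ^^ m') (?S k (Suc d) b)"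
      by (simp only: m funpow_Suc_right o_apply)
    then show ?case
      using ge2.IH(1)[of m' "Suc d"] ge2.prems m by (simp del: fun_upd_apply)
  qed (use stop in simp)
  from this[OF k, of 0 b] have "eval N (Loop body) \<sigma> = ?S 0 (Suc k div 2) (b \<or> odd k)"
    using \<sigma> by (simp add: fun_upd_idem)
  moreover have "eval N (flush rD rC) (?S 0 (Suc k div 2) (b \<or> odd k)) =
      \<sigma>(rC := replicate (Suc k div 2) 1, rB := flag (b \<or> odd k))"
    by (subst eval_flush) (use k \<sigma> in \<open>auto simp: fun_eq_iff\<close>)
  ultimately show ?thesis
    unfolding halve_def body_def[symmetric] eval.simps(5) by simp
qed

text \<open>Doubling up from 1 could produce a counter of exponential size, as the dimension of an
  input not yet accepted may be close to \<open>N\<close>. Halving the given counter, with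
  \<open>rH\<close> as a ruler for \<open>n\<close> halvings, never leaves the range of the
  loops.\<close>

definition power_check :: cmd where
  "power_check = Loop (on_sym rH (\<lambda>a. Pop rH ;; Push rH' a ;; halve)) ;; flush rH' rH ;;
     Test rC 0 (raise rB) Skip ;; Pop rC ;; Test rC 0 Skip (raise rB) ;; clear rC"

lemma eval_power_check:
  assumes \<sigma>: "\<sigma> rC = replicate k 1" "\<sigma> rD = []" "\<sigma> rB = flag b" "\<sigma> rH' = []"
    and h: "cube n (\<sigma> rH)" and N: "k \<le> N" "n \<le> N"
  shows "eval N power_check \<sigma> = \<sigma>(rC := [], rB := flag (b \<or> k \<noteq> 2 ^ n))"
proof -
  define body where "body = on_sym rH (\<lambda>a. Pop rH ;; Push rH' a ;; halve)"
  let ?S = "\<lambda>(hs, k, b) h. \<sigma>(rH := h, rH' := hs, rC := replicate k 1, rB := flag b)"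
  let ?f = "\<lambda>(hs, k, b) a. (a # hs, Suc k div 2, b \<or> odd k)"
  note h' = cubeD[OF h]
  have "(eval N body ^^ N) (?S ([], k, b) (\<sigma> rH)) = ?S (foldl ?f ([], k, b) (\<sigma> rH)) []"
  proof (rule funpow_drain_invariant[where X = "{1..4}" and I = "\<lambda>(hs, k, b). k \<le> N"])
    fix s :: "nat list \<times> nat \<times> bool" and a :: nat and h
    assume "case s of (hs, k, b) \<Rightarrow> k \<le> N" and a: "a \<in> {1..4}"
    then obtain hs k b where s: "s = (hs, k, b)" "k \<le> N"
      by (cases s) auto
    show "eval N body (?S s (a # h)) = ?S (?f s a) h"
      using a s \<sigma> unfolding body_def
      by (simp add: eval_halve[where k = k and b = b])
  qed (use h' N in \<open>auto simp: body_def\<close>)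
  \<comment> \<open>The invariant behind the halvings: \<open>k = 2 ^ Suc l\<close> iff
    \<open>k\<close> is even and its half is \<open>2 ^ l\<close>. An odd counter is rounded up, but
    it has then raised the flag for good.\<close>
  moreover have "\<exists>k' b'. foldl ?f (hs, k, b) h = (rev h @ hs, k', b') \<and> k' \<le> N \<and>
      (b' \<or> k' \<noteq> 1 \<longleftrightarrow> b \<or> k \<noteq> 2 ^ length h)" if "k \<le> N" for hs k b and h :: "nat list"
    using that
  proof (induction h arbitrary: hs k b)
    case (Cons a h)
    have "(b \<or> odd k) \<or> Suc k div 2 \<noteq> 2 ^ length h \<longleftrightarrow> b \<or> k \<noteq> 2 ^ Suc (length h)"
      by (auto elim!: evenE)
    then show ?case
      using Cons.IH[of "Suc k div 2" "a # hs" "b \<or> odd k"] Cons.prems by auto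
  qed auto
  from this[OF N(1), of "[]" b "\<sigma> rH"] obtain k' b' where
    f: "foldl ?f ([], k, b) (\<sigma> rH) = (rev (\<sigma> rH), k', b')" and k': "k' \<le> N"
    and b': "b' \<or> k' \<noteq> 1 \<longleftrightarrow> b \<or> k \<noteq> 2 ^ n"
    using h' by auto
  ultimately have 1: "eval N (Loop body) \<sigma> = ?S (rev (\<sigma> rH), k', b') []"
    using \<sigma> by (simp add: fun_upd_idem)
  let ?s2 = "\<sigma>(rC := replicate k' 1, rB := flag b')"
  have 2: "eval N (flush rH' rH) (?S (rev (\<sigma> rH), k', b') []) = ?s2"
    by (subst eval_flush) (use h' N \<sigma> in \<open>auto simp: fun_eq_iff\<close>)
  have 3: "eval N (Test rC 0 (raise rB) Skip ;; Pop rC ;; Test rC 0 Skip (raise rB)) ?s2 =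
      \<sigma>(rC := replicate (k' - 1) 1, rB := flag (b' \<or> k' \<noteq> 1))"
    by (cases k'; cases "k' - 1") (auto simp: raise_def flag_def fun_eq_iff)
  have 4: "eval N (clear rC) (\<sigma>(rC := replicate (k' - 1) 1, rB := flag (b' \<or> k' \<noteq> 1))) =
      \<sigma>(rC := [], rB := flag (b' \<or> k' \<noteq> 1))"
    by (subst eval_clear) (use k' in \<open>auto simp: fun_eq_iff\<close>)
  have "eval N power_check \<sigma> = \<sigma>(rC := [], rB := flag (b' \<or> k' \<noteq> 1))"
    unfolding power_check_def body_def[symmetric] eval.simps(5) 1 2 3[unfolded eval.simps(5)] 4 ..
  then show ?thesis
    by (simp only: b')
qed

section \<open>Parsing and validating the input\<close>

definition parse_entry :: "nat list \<times> nat list \<times> bool \<Rightarrow> nat list \<times> nat list \<times> bool" where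
  "parse_entry = (\<lambda>(i, e, b). if peek i \<in> {1, 2} then (tl i, peek i # e, b) else (i, e, True))"

definition parse_vec :: "nat \<Rightarrow> nat list \<times> nat list \<times> bool \<Rightarrow> nat list \<times> nat list \<times> bool" where
  "parse_vec n s = (case (parse_entry ^^ n) s of (i, e, b) \<Rightarrow>
     if peek i = 4 then (tl i, 4 # e, b) else (i, e, True))"

definition vec_parser :: cmd where
  "vec_parser =
     Loop (on_sym rH (\<lambda>a. Pop rH ;; Push rH' a ;;
       Test rI 1 (Pop rI ;; Push rE' 1) (Test rI 2 (Pop rI ;; Push rE' 2) (raise rB)))) ;;
     flush rH' rH ;; Test rI 4 (Pop rI ;; Push rE' 4) (raise rB)"

lemma eval_vec_parser:
  assumes h: "cube n (\<sigma> rH)" and "n \<le> N" "\<sigma> rH' = []"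
  shows "eval N vec_parser (\<sigma>(rI := i, rE' := e, rB := flag b)) =
    (case parse_vec n (i, e, b) of (i, e, b) \<Rightarrow> \<sigma>(rI := i, rE' := e, rB := flag b))"
proof -
  define body where "body = on_sym rH (\<lambda>a. Pop rH ;; Push rH' a ;;
       Test rI 1 (Pop rI ;; Push rE' 1) (Test rI 2 (Pop rI ;; Push rE' 2) (raise rB)))"
  let ?S = "\<lambda>(hs, i, e, b) h. \<sigma>(rH := h, rH' := hs, rI := i, rE' := e, rB := flag b)"
  let ?f = "\<lambda>(hs, s) a. (a # hs, parse_entry s)"
  note h' = cubeD[OF h]
  have "(eval N body ^^ N) (?S ([], i, e, b) (\<sigma> rH)) = ?S (foldl ?f ([], i, e, b) (\<sigma> rH)) []"
  proof (rule funpow_drain[where X = "{1..4}"])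
    fix s :: "nat list \<times> nat list \<times> nat list \<times> bool" and a :: nat and h
    assume a: "a \<in> {1..4}"
    obtain hs i e b where s: "s = (hs, i, e, b)"
      by (cases s) auto
    show "eval N body (?S s (a # h)) = ?S (?f s a) h"
      using a unfolding body_def s
      by (auto simp: parse_entry_def raise_def flag_def fun_eq_iff)
  qed (use h' assms in \<open>auto simp: body_def\<close>)
  moreover have "foldl ?f (hs, s) h = (rev h @ hs, (parse_entry ^^ length h) s)" for hs s and h :: "nat list"
    by (induction h arbitrary: hs s) (auto simp: funpow_swap1)
  moreover obtain i' e' b' where s: "(parse_entry ^^ n) (i, e, b) = (i', e', b')"
    by (cases "(parse_entry ^^ n) (i, e, b)")
  ultimately have "eval N (Loop body) (\<sigma>(rH := \<sigma> rH, rH' := [], rI := i, rE' := e, rB := flag b)) =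
      ?S (rev (\<sigma> rH), i', e', b') []"
    using h' by simp
  then have 1: "eval N (Loop body) (\<sigma>(rI := i, rE' := e, rB := flag b)) =
      ?S (rev (\<sigma> rH), i', e', b') []"
    using assms(3) by (simp add: fun_upd_idem)
  have 2: "eval N (flush rH' rH) (?S (rev (\<sigma> rH), i', e', b') []) =
      \<sigma>(rI := i', rE' := e', rB := flag b')"
    by (subst eval_flush) (use h' assms in \<open>auto simp: fun_eq_iff\<close>)
  show ?thesis
    unfolding vec_parser_def body_def[symmetric] eval.simps(5) 1 2
    by (auto simp: parse_vec_def s raise_def flag_def fun_eq_iff)
qed

text \<open>A failing round consumes nothing and sets the error bit, which is never cleared. A final
  \<open>False\<close> therefore certifies every round and the initial value of the bit.\<close>

lemma parse_entries_iff:
  "(parse_entry ^^ n) (i, e, b) = (i', e', False) \<longleftrightarrow>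
    \<not> b \<and> (\<exists>x. vec n x \<and> i = x @ i' \<and> e' = rev x @ e)"
proof (induction n arbitrary: i e b)
  case 0
  then show ?case
    by (auto simp: vec_def)
next
  case (Suc n)
  have vec: "vec (Suc n) x \<longleftrightarrow> (\<exists>a y. x = a # y \<and> a \<in> {1, 2} \<and> vec n y)" for x
    by (cases x) (auto simp: vec_def)
  have "(parse_entry ^^ Suc n) (i, e, b) = (if peek i \<in> {1, 2}
      then (parse_entry ^^ n) (tl i, peek i # e, b) else (parse_entry ^^ n) (i, e, True))"
    unfolding funpow_Suc_right o_apply by (simp add: parse_entry_def)
  then show ?case
    by (cases i) (auto simp: Suc.IH vec simp del: funpow.simps)
qed

lemma parse_vec_iff:
  "parse_vec n (i, e, b) = (i', e', False) \<longleftrightarrow>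
    \<not> b \<and> (\<exists>x. vec n x \<and> i = x @ 4 # i' \<and> e' = 4 # rev x @ e)"
proof -
  obtain i1 e1 b1 where s: "(parse_entry ^^ n) (i, e, b) = (i1, e1, b1)"
    by (cases "(parse_entry ^^ n) (i, e, b)")
  have "parse_vec n (i, e, b) = (i', e', False) \<longleftrightarrow>
      (\<exists>e2. (parse_entry ^^ n) (i, e, b) = (4 # i', e2, False) \<and> e' = 4 # e2)"
    by (cases i1) (auto simp: parse_vec_def s)
  then show ?thesis
    by (auto simp: parse_entries_iff)
qed

text \<open>After an error or at the end of the input the state is stationary, which takes care of
  the surplus rounds. The counter, kept in unary in \<open>rC\<close>, is later compared with
  \<open>2 ^ n\<close>.\<close>

definition parse_edge ::
    "nat \<Rightarrow> nat list \<times> nat list \<times> nat \<times> bool \<Rightarrow> nat list \<times> nat list \<times> nat \<times> bool" where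
  "parse_edge n = (\<lambda>(i, e, c, b). if b \<or> peek i = 0 then (i, e, c, b)
     else case parse_vec n (parse_vec n (i, e, b)) of (i, e, b) \<Rightarrow> (i, e, Suc c, b))"

lemma parse_edges_sound:
  assumes "(parse_edge n ^^ m) (i, e, c, b) = (i', e', c', False)"
  shows "\<not> b \<and> (\<exists>es. set es \<subseteq> Collect (vec n) \<times> Collect (vec n) \<and> i = words es @ i' \<and>
    e' = rev (words es) @ e \<and> c' = c + length es)"
  using assms
proof (induction m arbitrary: i e c b)
  case 0
  then show ?case
    by (auto intro: exI[of _ "[]"])
next
  case (Suc m)
  obtain i1 e1 c1 b1 where s: "parse_edge n (i, e, c, b) = (i1, e1, c1, b1)"
    by (cases "parse_edge n (i, e, c, b)")
  then have "(parse_edge n ^^ m) (i1, e1, c1, b1) = (i', e', c', False)"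
    using Suc.prems by (simp add: funpow_swap1)
  from Suc.IH[OF this] obtain es where es: "\<not> b1" "set es \<subseteq> Collect (vec n) \<times> Collect (vec n)"
    "i1 = words es @ i'" "e' = rev (words es) @ e1" "c' = c1 + length es"
    by auto
  show ?case
  proof (cases "b \<or> peek i = 0")
    case True
    then show ?thesis
      using s es by (auto simp: parse_edge_def)
  next
    case False
    obtain i2 e2 b2 where s2: "parse_vec n (i, e, b) = (i2, e2, b2)"
      by (cases "parse_vec n (i, e, b)")
    have 1: "parse_vec n (i2, e2, b2) = (i1, e1, False)" "c1 = Suc c"
      using s s2 False es(1) by (auto simp: parse_edge_def split: prod.splits)
    then obtain y where y: "vec n y" "i2 = y @ 4 # i1" "e1 = 4 # rev y @ e2" "\<not> b2"
      by (auto simp: parse_vec_iff)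
    then obtain x where "vec n x" "i = x @ 4 # i2" "e2 = 4 # rev x @ e"
      using s2 by (auto simp: parse_vec_iff)
    then show ?thesis
      using y es 1 False by (intro conjI exI[of _ "(x, y) # es"]) auto
  qed
qed

lemma parse_edges_complete:
  assumes "set es \<subseteq> Collect (vec n) \<times> Collect (vec n)" "length es \<le> m"
  shows "(parse_edge n ^^ m) (words es, e, c, False) = ([], rev (words es) @ e, c + length es, False)"
  using assms
proof (induction es arbitrary: m e c)
  case Nil
  have "(parse_edge n ^^ m) ([], e, c, False) = ([], e, c, False)"
    by (induction m) (auto simp: parse_edge_def)
  then show ?case
    by simp
next
  case (Cons p es)
  obtain x y m' where p: "p = (x, y)" "vec n x" "vec n y" and m: "m = Suc m'" "length es \<le> m'"
    using Cons.prems by (cases p; cases m) auto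
  have "peek (words (p # es)) \<noteq> 0"
    using p by (cases x) (auto simp: vec_def)
  moreover have "parse_vec n (words (p # es), e, False) = (y @ 4 # words es, 4 # rev x @ e, False)"
    using p by (auto simp: parse_vec_iff)
  moreover have "parse_vec n (y @ 4 # words es, 4 # rev x @ e, False) =
      (words es, 4 # rev y @ 4 # rev x @ e, False)"
    using p by (auto simp: parse_vec_iff)
  ultimately have "parse_edge n (words (p # es), e, c, False) =
      (words es, 4 # rev y @ 4 # rev x @ e, Suc c, False)"
    by (simp add: parse_edge_def)
  then have "(parse_edge n ^^ m) (words (p # es), e, c, False) =
      (parse_edge n ^^ m') (words es, 4 # rev y @ 4 # rev x @ e, Suc c, False)"
    by (simp only: m funpow_Suc_right o_apply)
  then show ?case
    using Cons.IH[OF _ m(2)] Cons.prems p by simp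
qed

definition validator :: cmd where
  "validator = Loop (Test rB 0 (Test rI 0 Skip (vec_parser ;; vec_parser ;; Push rC 1)) Skip) ;;
     Test rI 0 Skip (raise rB)"

lemma eval_validator:
  assumes h: "cube n (\<sigma> rH)" and "n \<le> N" "\<sigma> rH' = []"
    and \<sigma>: "\<sigma> rI = i" "\<sigma> rE' = []" "\<sigma> rC = []" "\<sigma> rB = flag b"
  shows "eval N validator \<sigma> = (case (parse_edge n ^^ N) (i, [], 0, b) of (i, e, c, b) \<Rightarrow>
    \<sigma>(rI := i, rE' := e, rC := replicate c 1, rB := flag (b \<or> peek i \<noteq> 0)))"
proof -
  define body where "body = Test rB 0 (Test rI 0 Skip (vec_parser ;; vec_parser ;; Push rC 1)) Skip"
  let ?S = "\<lambda>(i, e, c, b). \<sigma>(rI := i, rE' := e, rC := replicate c 1, rB := flag b)"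
  have step: "eval N body (?S s) = ?S (parse_edge n s)" for s
  proof -
    obtain i e c b where s: "s = (i, e, c, b)"
      by (cases s)
    obtain i1 e1 b1 where 1: "parse_vec n (i, e, b) = (i1, e1, b1)"
      by (cases "parse_vec n (i, e, b)")
    obtain i2 e2 b2 where 2: "parse_vec n (i1, e1, b1) = (i2, e2, b2)"
      by (cases "parse_vec n (i1, e1, b1)")
    have swap: "\<sigma>(rI := i, rE' := e, rC := replicate c 1, rB := flag b) =
        \<sigma>(rC := replicate c 1, rI := i, rE' := e, rB := flag b)" for i e c b
      by (auto simp: fun_eq_iff)
    have parser: "eval N vec_parser (\<sigma>(rC := replicate c 1, rI := i, rE' := e, rB := flag b)) =
        (case parse_vec n (i, e, b) of (i, e, b) \<Rightarrow>
          \<sigma>(rC := replicate c 1, rI := i, rE' := e, rB := flag b))" for i e c b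
      by (rule eval_vec_parser) (use assms in auto)
    have seq: "eval N (vec_parser ;; vec_parser ;; Push rC 1) (?S s) = ?S (i2, e2, Suc c, b2)"
      unfolding s split swap eval.simps(5) parser 1 2 by (auto simp: fun_eq_iff)
    show ?thesis
    proof (cases "b \<or> peek i = 0")
      case True
      then show ?thesis
        by (auto simp: s body_def parse_edge_def)
    next
      case False
      then have "eval N body (?S s) = eval N (vec_parser ;; vec_parser ;; Push rC 1) (?S s)"
        by (simp add: s body_def)
      then show ?thesis
        unfolding seq using False 1 2 by (simp add: s parse_edge_def)
    qed
  qed
  have "(eval N body ^^ m) (?S s) = ?S ((parse_edge n ^^ m) s)" for m s
    by (induction m) (simp_all only: step funpow.simps o_apply id_apply)
  moreover have "?S (i, [], 0, b) = \<sigma>"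
    using \<sigma> by (auto simp: fun_eq_iff)
  ultimately have loop: "eval N (Loop body) \<sigma> = ?S ((parse_edge n ^^ N) (i, [], 0, b))"
    by (metis eval.simps(6))
  obtain i' e' c' b' where s: "(parse_edge n ^^ N) (i, [], 0, b) = (i', e', c', b')"
    by (cases "(parse_edge n ^^ N) (i, [], 0, b)")
  show ?thesis
    unfolding validator_def body_def[symmetric] eval.simps(5) loop s
    by (auto simp: raise_def flag_def fun_eq_iff)
qed

definition header :: "bool \<Rightarrow> cmd" where
  "header strict =
     Loop (on_sym rI (\<lambda>a. if a = 4 then Skip
       else (if strict \<and> a = 3 then raise rB else Skip) ;; Pop rI ;; Push rH' a)) ;;
     Test rI 4 Skip (raise rB) ;; Pop rI ;; flush rH' rH"

text \<open>The word is split at its first terminator, where the loop idles; \<open>r = []\<close>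
  is the case of a word without any, which is rejected.\<close>

lemma eval_header:
  assumes h: "cube n h" "length h \<le> N" and r: "r = [] \<or> peek r = 4"
    and \<sigma>: "\<sigma> rI = h @ r" "\<sigma> rH = []" "\<sigma> rH' = []" "\<sigma> rB = []"
  shows "eval N (header strict) \<sigma> =
    \<sigma>(rI := tl r, rH := h, rB := flag (r = [] \<or> strict \<and> 3 \<in> set h))"
proof -
  define body where "body = on_sym rI (\<lambda>a. if a = 4 then Skip
       else (if strict \<and> a = 3 then raise rB else Skip) ;; Pop rI ;; Push rH' a)"
  let ?S = "\<lambda>(hs, b) h. \<sigma>(rB := flag b, rI := h @ r, rH' := hs)"
  let ?f = "\<lambda>(hs, b) a. (a # hs, b \<or> strict \<and> a = 3)"
  note h' = cubeD[OF h(1)]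
  have "(eval N body ^^ N) (?S ([], False) h) = ?S (foldl ?f ([], False) h) []"
  proof (rule funpow_drain[where X = "{1, 2, 3}"])
    fix s :: "nat list \<times> bool" and a :: nat and h
    assume a: "a \<in> {1, 2, 3}"
    show "eval N body (?S s (a # h)) = ?S (?f s a) h"
      using a by (cases s) (auto simp: body_def raise_def flag_def fun_eq_iff)
  qed (use h r in \<open>auto simp: body_def cube_def\<close>)
  moreover have "foldl ?f (hs, b) h = (rev h @ hs, b \<or> strict \<and> 3 \<in> set h)" for hs b
    by (induction h arbitrary: hs b) auto
  moreover have "?S ([], False) h = \<sigma>"
    using \<sigma> by (auto simp: fun_eq_iff)
  ultimately have 1: "eval N (Loop body) \<sigma> = \<sigma>(rB := flag (strict \<and> 3 \<in> set h), rI := r, rH' := rev h)"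
    by simp
  have 2: "eval N (Test rI 4 Skip (raise rB) ;; Pop rI)
      (\<sigma>(rB := flag (strict \<and> 3 \<in> set h), rI := r, rH' := rev h)) =
      \<sigma>(rB := flag (r = [] \<or> strict \<and> 3 \<in> set h), rI := tl r, rH' := rev h)"
    using r by (auto simp: raise_def flag_def fun_eq_iff)
  have 3: "eval N (flush rH' rH) (\<sigma>(rB := flag (r = [] \<or> strict \<and> 3 \<in> set h), rI := tl r, rH' := rev h)) =
      \<sigma>(rI := tl r, rH := h, rB := flag (r = [] \<or> strict \<and> 3 \<in> set h))"
    by (subst eval_flush) (use h' h(2) \<sigma> in \<open>auto simp: fun_eq_iff\<close>)
  show ?thesis
    unfolding header_def body_def[symmetric] eval.simps(5) 1 2[unfolded eval.simps(5)] 3 ..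
qed

section \<open>The two tests applied to each edge\<close>

definition trap_check :: cmd where
  "trap_check = Test rY 0 (Test rZ 0 Skip (raise rB)) Skip ;; clear rG ;; clear rD"

lemma check_spec_trap:
  assumes "n \<le> N"
  shows "check_spec N n es h trap_check (\<lambda>x y. vmatch h x \<and> \<not> vmatch h y)"
  unfolding check_spec_def
proof (intro allI impI)
  fix \<sigma> x y b
  assume xy: "vec n x" "vec n y" and \<sigma>: "\<sigma> rG = x" "\<sigma> rD = rev y" "\<sigma> rB = flag b"
    "\<sigma> rY = flag (\<not> vmatch h x)" "\<sigma> rZ = flag (\<not> vmatch h y)"
  let ?b = "b \<or> vmatch h x \<and> \<not> vmatch h y"
  have 1: "eval N (Test rY 0 (Test rZ 0 Skip (raise rB)) Skip) \<sigma> = \<sigma>(rB := flag ?b)"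
    using \<sigma> by (auto simp: raise_def flag_def fun_eq_iff)
  have 2: "eval N (clear rG) (\<sigma>(rB := flag ?b)) = \<sigma>(rB := flag ?b, rG := [])"
    by (rule eval_clear) (use vecD[OF xy(1)] assms \<sigma> in simp)
  have 3: "eval N (clear rD) (\<sigma>(rB := flag ?b, rG := [])) = \<sigma>(rB := flag ?b, rG := [], rD := [])"
    by (rule eval_clear) (use vecD[OF xy(2)] assms \<sigma> in simp)
  show "eval N trap_check \<sigma> = \<sigma>(rG := [], rD := [], rB := flag ?b)"
    unfolding trap_check_def eval.simps(5) 1 2 3 by (auto simp: fun_eq_iff)
qed

definition closure_check :: cmd where
  "closure_check = clear rD ;; Loop join_pass ;; walk (=) rH rH' rG rD rK ;; flush rH' rH ;;
     Test rY 0 (Test rK 0 Skip (raise rB)) Skip ;; Pop rK ;; clear rD"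

text \<open>The loop over the edges serves as a loop over all configurations here: the test concerns
  the source, whose closure grows in \<open>rG\<close> itself. The target is cleared from
  \<open>rD\<close> first, because the comparison with \<open>h\<close> moves the closure
  there.\<close>

lemma check_spec_closure:
  assumes es: "edges_ok N n es" and h: "cube n h"
  shows "check_spec N n es h closure_check (\<lambda>x y. vmatch h x \<and> h \<noteq> (sweep_join es ^^ N) x)"
  unfolding check_spec_def
proof (intro allI impI)
  fix \<sigma> x y b
  assume idle: "idle \<sigma>" and xy: "vec n x" "vec n y"
    and \<sigma>: "\<sigma> rE = words es" "\<sigma> rH = h" "\<sigma> rG = x" "\<sigma> rD = rev y" "\<sigma> rB = flag b"
    "\<sigma> rY = flag (\<not> vmatch h x)"
  have n: "n \<le> N"
    using es by (simp add: edges_ok_def)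
  define g where "g = (sweep_join es ^^ N) x"
  have "cube n ((sweep_join es ^^ k) x)" for k
    using vec_imp_cube[OF xy(1)] cube_sweep_join[OF es] by (induction k) auto
  then have g: "cube n g"
    by (simp add: g_def)
  note len = cubeD[OF h] cubeD[OF g]
  note \<sigma>' = idle[unfolded idle_def] \<sigma>
  let ?b = "b \<or> vmatch h x \<and> h \<noteq> g"
  have 1: "eval N (clear rD) \<sigma> = \<sigma>(rD := [])"
    by (rule eval_clear) (use vecD[OF xy(2)] n \<sigma> in simp)
  have 2: "eval N (Loop join_pass) (\<sigma>(rD := [])) = \<sigma>(rD := [], rG := g)"
    using eval_join_passes[OF es, of "\<sigma>(rD := [])"] vec_imp_cube[OF xy(1)] \<sigma>' by (simp add: g_def)
  let ?s3 = "\<sigma>(rD := rev g, rK := flag (h \<noteq> g), rH := [], rH' := rev h, rG := [])"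
  have 3: "eval N (walk (=) rH rH' rG rD rK) (\<sigma>(rD := [], rG := g)) = ?s3"
    by (subst eval_walk[where us = g and rest = "[]" and b = False])
      (use len n \<sigma>' in \<open>auto simp: list_all2_eq[symmetric] fun_eq_iff\<close>)
  let ?s4 = "\<sigma>(rD := rev g, rK := flag (h \<noteq> g), rG := [])"
  have 4: "eval N (flush rH' rH) ?s3 = ?s4"
    by (subst eval_flush) (use len n \<sigma>' in \<open>auto simp: fun_eq_iff\<close>)
  have 5: "eval N (Test rY 0 (Test rK 0 Skip (raise rB)) Skip ;; Pop rK) ?s4 =
      \<sigma>(rD := rev g, rG := [], rB := flag ?b)"
    using \<sigma>' by (auto simp: raise_def flag_def fun_eq_iff)
  have 6: "eval N (clear rD) (\<sigma>(rD := rev g, rG := [], rB := flag ?b)) =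
      \<sigma>(rG := [], rB := flag ?b, rD := [])"
    by (subst eval_clear) (use len n in \<open>auto simp: fun_eq_iff\<close>)
  show "eval N closure_check \<sigma> =
      \<sigma>(rG := [], rD := [], rB := flag (b \<or> vmatch h x \<and> h \<noteq> (sweep_join es ^^ N) x))"
    unfolding closure_check_def eval.simps(5) 1 2 3 4 5[unfolded eval.simps(5)] 6
    by (auto simp: fun_eq_iff g_def)
qed

definition source_loop :: "cmd \<Rightarrow> cmd" where
  "source_loop check = Loop (Test rF 0 Skip (source_step check))"

lemma eval_source_loop:
  assumes es: "edges_ok N n es" and h: "cube n h"
    and check: "check_spec N n es h check bad"
    and \<sigma>: "idle \<sigma>" "\<sigma> rE = words es" "\<sigma> rH = h" "\<sigma> rF = words es" "\<sigma> rB = flag b"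
      "\<sigma> rG = []" "\<sigma> rD = []" "\<sigma> rY = []" "\<sigma> rZ = []"
  shows "eval N (source_loop check) \<sigma> = \<sigma>(rF := [], rB := flag (b \<or>
    (\<exists>(x, y)\<in>set es. length (filter (vmatch x \<circ> fst) es) > 1 \<or> bad x y)))"
proof -
  define viol where "viol = (\<lambda>(x, y). length (filter (vmatch x \<circ> fst) es) > 1 \<or> bad x y)"
  let ?S = "\<lambda>b ps. \<sigma>(rF := words ps, rB := flag b)"
  let ?f = "\<lambda>b p. b \<or> viol p"
  have "(eval N (Test rF 0 Skip (source_step check)) ^^ N) (?S b es) = ?S (foldl ?f b es) []"
  proof (rule funpow_drain[where X = "Collect (vec n) \<times> Collect (vec n)"])
    fix b p ps
    assume "p \<in> Collect (vec n) \<times> Collect (vec n)"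
    then obtain x y where p: "p = (x, y)" and xy: "vec n x" "vec n y"
      by auto
    have "peek (words (p # ps)) \<noteq> 0"
      using p xy by (cases x) (auto simp: vec_def)
    moreover have "eval N (source_step check) (?S b (p # ps)) =
        (?S b (p # ps))(rF := words ps, rB := flag (b \<or> length (filter (vmatch x \<circ> fst) es) > 1 \<or> bad x y))"
      by (rule eval_source_step[OF es h xy check]) (use \<sigma> p in \<open>auto simp: idle_def\<close>)
    ultimately show "eval N (Test rF 0 Skip (source_step check)) (?S b (p # ps)) = ?S (?f b p) ps"
      by (simp add: p viol_def)
  qed (use es length_words[of es] in \<open>auto simp: edges_ok_def\<close>)
  moreover have "foldl ?f b ps = (b \<or> (\<exists>p\<in>set ps. viol p))" for b ps
    by (induction ps arbitrary: b) auto
  moreover have "?S b es = \<sigma>"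
    using \<sigma> by (auto simp: fun_eq_iff)
  ultimately show ?thesis
    by (simp add: source_loop_def viol_def)
qed

text \<open>A flush reverses, so every transfer between \<open>rH\<close> and \<open>rG\<close>
  takes two of them.\<close>

definition initial_closure :: cmd where
  "initial_closure = flush rH rH' ;; flush rH' rG ;; Loop join_pass ;; flush rG rG' ;; flush rG' rH"

text \<open>A preparation may exchange the cube to be tested: membership in a minimal trap space is
  decided by testing the closure of the given configuration.\<close>

definition prep_spec ::
    "nat \<Rightarrow> nat \<Rightarrow> (nat list \<times> nat list) list \<Rightarrow> nat list \<Rightarrow> cmd \<Rightarrow> nat list \<Rightarrow> bool" where
  "prep_spec N n es h prep h' \<longleftrightarrow> cube n h' \<and> (\<forall>\<sigma>. idle \<sigma> \<longrightarrow> \<sigma> rE = words es \<longrightarrow> \<sigma> rH = h \<longrightarrow>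
     \<sigma> rG = [] \<longrightarrow> eval N prep \<sigma> = \<sigma>(rH := h'))"

lemma prep_spec_Skip: "cube n h \<Longrightarrow> prep_spec N n es h Skip h"
  by (auto simp: prep_spec_def fun_eq_iff)

lemma prep_spec_initial_closure:
  assumes es: "edges_ok N n es" and h: "cube n h"
  shows "prep_spec N n es h initial_closure ((sweep_join es ^^ N) h)"
  unfolding prep_spec_def
proof (intro conjI allI impI)
  define g where "g = (sweep_join es ^^ N) h"
  have "cube n ((sweep_join es ^^ k) h)" for k
    using h cube_sweep_join[OF es] by (induction k) auto
  then have g: "cube n g"
    by (simp add: g_def)
  then show "cube n ((sweep_join es ^^ N) h)"
    by (simp add: g_def)
  have n: "n \<le> N"
    using es by (simp add: edges_ok_def)
  note len = cubeD[OF h] cubeD[OF g]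
  fix \<sigma>
  assume idle: "idle \<sigma>" and \<sigma>: "\<sigma> rE = words es" "\<sigma> rH = h" "\<sigma> rG = []"
  note \<sigma>' = idle[unfolded idle_def] \<sigma>
  have 1: "eval N (flush rH rH') \<sigma> = \<sigma>(rH := [], rH' := rev h)"
    by (subst eval_flush) (use len n \<sigma>' in \<open>auto simp: fun_eq_iff\<close>)
  have 2: "eval N (flush rH' rG) (\<sigma>(rH := [], rH' := rev h)) = \<sigma>(rH := [], rG := h)"
    by (subst eval_flush) (use len n \<sigma>' in \<open>auto simp: fun_eq_iff\<close>)
  have 3: "eval N (Loop join_pass) (\<sigma>(rH := [], rG := h)) = \<sigma>(rH := [], rG := g)"
    using eval_join_passes[OF es, of "\<sigma>(rH := [], rG := h)"] h \<sigma>' by (simp add: g_def)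
  have 4: "eval N (flush rG rG') (\<sigma>(rH := [], rG := g)) = \<sigma>(rH := [], rG' := rev g)"
    by (subst eval_flush) (use len n \<sigma>' in \<open>auto simp: fun_eq_iff\<close>)
  have 5: "eval N (flush rG' rH) (\<sigma>(rH := [], rG' := rev g)) = \<sigma>(rH := g)"
    by (subst eval_flush) (use len n \<sigma>' in \<open>auto simp: fun_eq_iff\<close>)
  have "eval N initial_closure \<sigma> = \<sigma>(rH := g)"
    unfolding initial_closure_def eval.simps(5) 1 2 3 4 5 ..
  then show "eval N initial_closure \<sigma> = \<sigma>(rH := (sweep_join es ^^ N) h)"
    by (simp only: g_def)
qed

text \<open>The parser leaves the edges reversed in \<open>rE'\<close>. Two copies are made because
  the outer loop over the sources consumes \<open>rF\<close> while each inner pass runs through all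
  of \<open>rE\<close>.\<close>

definition unpack :: cmd where
  "unpack = Loop (on_sym rE' (\<lambda>a. Pop rE' ;; Push rE a ;; Push rF a))"

lemma eval_unpack:
  assumes "set (\<sigma> rE') \<subseteq> {1..4}" "length (\<sigma> rE') \<le> N" "\<sigma> rE = []" "\<sigma> rF = []"
  shows "eval N unpack \<sigma> = \<sigma>(rE' := [], rE := rev (\<sigma> rE'), rF := rev (\<sigma> rE'))"
proof -
  let ?S = "\<lambda>es xs. \<sigma>(rE' := xs, rE := es, rF := es)"
  have "(eval N (on_sym rE' (\<lambda>a. Pop rE' ;; Push rE a ;; Push rF a)) ^^ N) (?S [] (\<sigma> rE')) =
      ?S (foldl (\<lambda>ys x. x # ys) [] (\<sigma> rE')) []"
    by (rule funpow_drain[where X = "{1..4}"]) (use assms in auto)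
  moreover have "?S [] (\<sigma> rE') = \<sigma>"
    using assms by (auto simp: fun_eq_iff)
  ultimately show ?thesis
    by (simp add: unpack_def foldl_push)
qed

section \<open>Assembly and correctness of the deciders\<close>

definition decider :: "bool \<Rightarrow> cmd \<Rightarrow> cmd \<Rightarrow> cmd" where
  "decider strict prep check = header strict ;; validator ;;
     Test rB 0 (unpack ;; power_check ;; prep ;; source_loop check) Skip"

definition valid_input ::
    "bool \<Rightarrow> nat \<Rightarrow> nat list \<Rightarrow> (nat list \<times> nat list) list \<Rightarrow> bool" where
  "valid_input strict n h es \<longleftrightarrow> cube n h \<and> (strict \<longrightarrow> vec n h) \<and>
     set es \<subseteq> Collect (vec n) \<times> Collect (vec n)"

lemma eval_decider_valid:
  assumes valid: "valid_input strict n h es" and N: "N = length (h @ 4 # words es)"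
    and prep: "prep_spec N n es h prep h'" and check: "check_spec N n es h' check bad"
  shows "peek (eval N (decider strict prep check) ((\<lambda>_. [])(rI := h @ 4 # words es)) rB) = 0 \<longleftrightarrow>
    length es = 2 ^ n \<and>
    (\<forall>(x, y)\<in>set es. length (filter (vmatch x \<circ> fst) es) \<le> 1 \<and> \<not> bad x y)"
proof -
  have h: "cube n h" "length h = n" and vecs: "set es \<subseteq> Collect (vec n) \<times> Collect (vec n)"
    and strict: "\<not> (strict \<and> 3 \<in> set h)"
    using valid by (auto simp: valid_input_def cube_def vec_def)
  have n: "n \<le> N" "length es \<le> N" "length (words es) \<le> N"
    using N h length_words[of es] by auto
  have es: "edges_ok N n es"
    using vecs n by (simp add: edges_ok_def)
  have h': "cube n h'"
    using prep by (simp add: prep_spec_def)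
  let ?\<sigma> = "(\<lambda>_. [])(rI := h @ 4 # words es)"
  let ?s1 = "(\<lambda>_. [])(rI := words es, rH := h)"
  have 1: "eval N (header strict) ?\<sigma> = ?s1"
    by (subst eval_header[where h = h and r = "4 # words es" and n = n])
      (use h n strict in \<open>auto simp: fun_eq_iff\<close>)
  let ?s2 = "(\<lambda>_. [])(rH := h, rE' := rev (words es), rC := replicate (length es) 1)"
  have 2: "eval N validator ?s1 = ?s2"
    by (subst eval_validator[where n = n and i = "words es" and b = False])
      (use h n parse_edges_complete[OF vecs n(2), of "[]" 0] in \<open>auto simp: fun_eq_iff\<close>)
  let ?s3 = "(\<lambda>_. [])(rH := h, rC := replicate (length es) 1, rE := words es, rF := words es)"
  have 3: "eval N unpack ?s2 = ?s3"
    by (subst eval_unpack) (use set_words[OF vecs] n in \<open>auto simp: fun_eq_iff\<close>)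
  let ?s4 = "(\<lambda>_. [])(rH := h, rE := words es, rF := words es, rB := flag (length es \<noteq> 2 ^ n))"
  have 4: "eval N power_check ?s3 = ?s4"
    by (subst eval_power_check[where k = "length es" and b = False and n = n])
      (use h n in \<open>auto simp: fun_eq_iff\<close>)
  have 5: "eval N prep ?s4 = ?s4(rH := h')"
    using prep by (simp add: prep_spec_def idle_def)
  have 6: "eval N (source_loop check) (?s4(rH := h')) = (?s4(rH := h'))(rF := [], rB := flag (length es \<noteq> 2 ^ n \<or>
    (\<exists>(x, y)\<in>set es. length (filter (vmatch x \<circ> fst) es) > 1 \<or> bad x y)))"
    by (rule eval_source_loop[OF es h' check]) (auto simp: idle_def)
  have "eval N (decider strict prep check) ?\<sigma> =
      eval N (source_loop check) (?s4(rH := h'))"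
    unfolding decider_def eval.simps(5) 1 2 using 3 4 5 by simp
  then show ?thesis
    unfolding 6 by auto
qed

text \<open>The commands behind the guard of \<open>decider\<close> are specified for well-formed
  inputs only. An error raised before the guard skips them and remains the verdict, so acceptance
  shows that the parse succeeded.\<close>

lemma accepted_input_valid:
  assumes w: "w \<in> lists {1..4}"
    and accept: "peek (eval (length w) (decider strict prep check) ((\<lambda>_. [])(rI := w)) rB) = 0"
  obtains n h es where "w = h @ 4 # words es" "valid_input strict n h es"
proof -
  define N where "N = length w"
  define h where "h = takeWhile (\<lambda>a. a \<noteq> 4) w"
  define r where "r = dropWhile (\<lambda>a. a \<noteq> 4) w"
  define n where "n = length h"
  have w_eq: "w = h @ r"
    by (simp add: h_def r_def)
  have set_w: "set w \<subseteq> {1..4}"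
    using w by auto
  have h: "cube n h"
  proof -
    have "a \<in> {1, 2, 3}" if "a \<in> set h" for a
      using that set_w set_takeWhileD[of a "\<lambda>a. a \<noteq> 4" w] unfolding h_def
      by (fastforce simp: numeral_eq_Suc)
    then show ?thesis
      by (auto simp: cube_def n_def)
  qed
  have "peek r = 4" if "r \<noteq> []"
    using hd_dropWhile[OF that[unfolded r_def], folded r_def] that by (cases r) auto
  then have r: "r = [] \<or> peek r = 4"
    by blast
  have n: "n \<le> N"
    by (simp add: n_def N_def w_eq)
  let ?b = "r = [] \<or> strict \<and> 3 \<in> set h"
  let ?s1 = "(\<lambda>_. [])(rI := tl r, rH := h, rB := flag ?b)"
  have 1: "eval N (header strict) ((\<lambda>_. [])(rI := w)) = ?s1"
    by (subst eval_header[where h = h and r = r and n = n])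
      (use h n r w_eq in \<open>auto simp: fun_eq_iff n_def\<close>)
  obtain i e c b where p: "(parse_edge n ^^ N) (tl r, [], 0, ?b) = (i, e, c, b)"
    by (cases "(parse_edge n ^^ N) (tl r, [], 0, ?b)")
  have 2: "eval N validator ?s1 = ?s1(rI := i, rE' := e, rC := replicate c 1, rB := flag (b \<or> peek i \<noteq> 0))"
    by (subst eval_validator[where n = n and i = "tl r" and b = "?b"]) (use h n p in auto)
  have "\<not> (b \<or> peek i \<noteq> 0)"
  proof
    assume "b \<or> peek i \<noteq> 0"
    then have "eval N (decider strict prep check) ((\<lambda>_. [])(rI := w)) =
        ?s1(rI := i, rE' := e, rC := replicate c 1, rB := flag (b \<or> peek i \<noteq> 0))"
      unfolding decider_def eval.simps(5) 1 2 by simp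
    then show False
      using accept \<open>b \<or> peek i \<noteq> 0\<close> by (simp add: N_def)
  qed
  then have b: "\<not> b" "peek i = 0"
    by auto
  then obtain es where es: "\<not> ?b" "set es \<subseteq> Collect (vec n) \<times> Collect (vec n)" "tl r = words es @ i"
    using parse_edges_sound[of N n "tl r" "[]" 0 ?b i e c] p by auto
  have "set (tl r) \<subseteq> set w"
    using w_eq by (cases r) auto
  then have "set i \<subseteq> {1..4}"
    using set_w es(3) by auto
  \<comment> \<open>Input symbols are nonzero, so a top of 0 means that nothing is left.\<close>
  then have "i = []"
    using b(2) by (cases i) auto
  then have "w = h @ 4 # words es"
    using es r w_eq by (cases r) auto
  moreover have "valid_input strict n h es"
    using h es by (auto simp: valid_input_def vec_def cube_def)
  ultimately show ?thesis
    using that by blast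
qed

section \<open>Minimal trap spaces as closures\<close>

lemma in_vertices_iff: "x \<in> vertices h \<longleftrightarrow> list_all2 (\<lambda>a b. a = None \<or> a = Some b) h x"
  by (auto simp: vertices_def configs_def list_all2_conv_all_nth)

lemma length_vertices: "x \<in> vertices h \<Longrightarrow> length x = length h"
  by (simp add: vertices_def configs_def)

text \<open>Any \<open>d\<close> yields a witness that the sub-hypercube is nonempty;
  \<open>d\<close> chosen against a fixed entry of another sub-hypercube exposes a star.\<close>

definition fill :: "bool \<Rightarrow> hypercube \<Rightarrow> bool list" where
  "fill d h = map (\<lambda>a. case a of None \<Rightarrow> d | Some b \<Rightarrow> b) h"

lemma fill_in_vertices: "fill d h \<in> vertices h"
  by (auto simp: in_vertices_iff fill_def list_all2_conv_all_nth split: option.split)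

definition below :: "hypercube \<Rightarrow> hypercube \<Rightarrow> bool" where
  "below = list_all2 (\<lambda>a b. b = None \<or> a = b)"

lemma vertices_mono_iff:
  assumes "length h = length h'" shows "vertices h \<subseteq> vertices h' \<longleftrightarrow> below h h'"
proof
  assume sub: "vertices h \<subseteq> vertices h'"
  have "h' ! i = None \<or> h ! i = h' ! i" if i: "i < length h'" for i
  proof (cases "h' ! i")
    case (Some b)
    \<comment> \<open>All stars of \<open>h\<close> receive the wrong bit, so agreement with
      \<open>Some b\<close> at position \<open>i\<close> must come from a fixed entry of
      \<open>h\<close>.\<close>
    have "fill (\<not> b) h \<in> vertices h'"
      using sub fill_in_vertices by blast
    then have "fill (\<not> b) h ! i = b"
      using i Some by (auto simp: in_vertices_iff list_all2_conv_all_nth)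
    then show ?thesis
      using i Some assms by (auto simp: fill_def split: option.splits)
  qed simp
  then show "below h h'"
    using assms by (auto simp: below_def list_all2_conv_all_nth)
next
  assume "below h h'"
  then show "vertices h \<subseteq> vertices h'"
    by (auto simp: below_def in_vertices_iff list_all2_conv_all_nth) metis
qed

lemma vertices_inj:
  assumes "length h = length h'" "vertices h = vertices h'" shows "h = h'"
proof (rule nth_equalityI)
  fix i assume "i < length h"
  then show "h ! i = h' ! i"
    using assms vertices_mono_iff[of h h'] vertices_mono_iff[of h' h]
    by (simp add: below_def list_all2_conv_all_nth) metis
qed (fact assms)

definition join_config :: "hypercube \<Rightarrow> bool list \<Rightarrow> hypercube" where
  "join_config = map2 (\<lambda>a b. if a = Some b then a else None)"

lemma length_join_config [simp]: "length (join_config h y) = min (length h) (length y)"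
  by (simp add: join_config_def)

lemma join_config_above: "length y = length h \<Longrightarrow> below h (join_config h y)"
  by (auto simp: below_def join_config_def list_all2_conv_all_nth)

lemma join_config_least: "below h h' \<Longrightarrow> y \<in> vertices h' \<Longrightarrow> below (join_config h y) h'"
  by (auto simp: below_def in_vertices_iff join_config_def list_all2_conv_all_nth) metis

lemma join_config_eq_iff: "length y = length h \<Longrightarrow> join_config h y = h \<longleftrightarrow> y \<in> vertices h"
  by (auto simp: in_vertices_iff join_config_def list_all2_conv_all_nth list_eq_iff_nth_eq)

definition stars :: "hypercube \<Rightarrow> nat" where
  "stars h = length (filter ((=) None) h)"

text \<open>Joining only turns fixed entries into stars, so an equal number of stars means an equal
  cube. This makes \<open>stars\<close> the progress measure of the closure.\<close>

lemma stars_join_config: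
  assumes "length y = length h"
  shows "stars h \<le> stars (join_config h y) \<and> (stars (join_config h y) \<le> stars h \<longrightarrow> join_config h y = h)"
  using assms[symmetric] by (induction h y rule: list_induct2) (auto simp: stars_def join_config_def)

type_synonym edges = "(bool list \<times> bool list) list"

section \<open>Sweeps of joins and their fixed points\<close>

definition absorb :: "edges \<Rightarrow> hypercube \<Rightarrow> hypercube" where
  "absorb es h = foldl (\<lambda>h (x, y). if x \<in> vertices h then join_config h y else h) h es"

lemma absorb_simps [simp]:
  "absorb [] h = h"
  "absorb ((x, y) # es) h = absorb es (if x \<in> vertices h then join_config h y else h)"
  by (simp_all add: absorb_def)

lemma length_absorb:
  "snd ` set es \<subseteq> configs (length h) \<Longrightarrow> length (absorb es h) = length h"
  by (induction es arbitrary: h) (auto simp: configs_def)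

text \<open>The number of stars never drops within a sweep. If it has not grown at the end, no
  single join changed the cube, so every edge was tested against the same \<open>h\<close> and found
  to respect it.\<close>

lemma stars_absorb:
  assumes "snd ` set es \<subseteq> configs (length h)"
  shows "stars h \<le> stars (absorb es h) \<and> (stars (absorb es h) \<le> stars h \<longrightarrow>
    absorb es h = h \<and> (\<forall>(x, y)\<in>set es. x \<in> vertices h \<longrightarrow> y \<in> vertices h))"
  using assms
proof (induction es arbitrary: h)
  case (Cons e es)
  obtain x y where e: "e = (x, y)"
    by (cases e)
  define h1 where "h1 = (if x \<in> vertices h then join_config h y else h)"
  have y: "length y = length h"
    using Cons.prems by (simp add: e configs_def)
  have "stars h \<le> stars h1" "stars h1 \<le> stars h \<longrightarrow> h1 = h" "length h1 = length h"
    using stars_join_config[OF y] y by (auto simp: h1_def)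
  moreover have "x \<in> vertices h \<longrightarrow> y \<in> vertices h" if "h1 = h"
    using that join_config_eq_iff[OF y] by (auto simp: h1_def)
  moreover have "absorb (e # es) h = absorb es h1"
    by (simp add: e h1_def)
  ultimately show ?case
    using Cons.IH[of h1] Cons.prems by (fastforce simp: e)
qed simp

text \<open>If \<open>h'\<close> is closed under the edges and contains the current cube, it
  contains each absorbed source and hence its target, and therefore also the least cube around
  both.\<close>

lemma absorb_below:
  assumes "\<And>x y. (x, y) \<in> set es \<Longrightarrow> x \<in> vertices h' \<Longrightarrow> y \<in> vertices h'" "below h h'"
  shows "below (absorb es h) h'"
  using assms
proof (induction es arbitrary: h)
  case (Cons e es)
  obtain x y where e: "e = (x, y)"
    by (cases e)
  have "vertices h \<subseteq> vertices h'"
    using Cons.prems(2) vertices_mono_iff[of h h'] by (simp add: below_def list_all2_lengthD)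
  then have "below (if x \<in> vertices h then join_config h y else h) h'"
    using Cons.prems join_config_least[of h h' y] by (auto simp: e)
  then have "below (absorb es (if x \<in> vertices h then join_config h y else h)) h'"
    using Cons.prems(1) by (intro Cons.IH) auto
  then show ?case
    by (simp only: e absorb_simps)
qed simp

lemma absorb_above:
  "snd ` set es \<subseteq> configs (length h) \<Longrightarrow> vertices h \<subseteq> vertices (absorb es h)"
proof (induction es arbitrary: h)
  case (Cons e es)
  obtain x y where e: "e = (x, y)"
    by (cases e)
  define h1 where "h1 = (if x \<in> vertices h then join_config h y else h)"
  have y: "length y = length h"
    using Cons.prems by (simp add: e configs_def)
  have "vertices h \<subseteq> vertices h1"
    using vertices_mono_iff[of h "join_config h y"] join_config_above[OF y] y by (auto simp: h1_def)
  moreover have "vertices h1 \<subseteq> vertices (absorb es h1)"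
    using Cons y by (auto simp: h1_def)
  ultimately show ?case
    by (auto simp: e h1_def)
qed simp

definition graph_of :: "nat \<Rightarrow> (bool list \<Rightarrow> bool list) \<Rightarrow> edges \<Rightarrow> bool" where
  "graph_of n f es \<longleftrightarrow> boolean_network n f \<and> lists_graph es n f"

lemma graph_ofD:
  assumes "graph_of n f es"
  shows "(x, y) \<in> set es \<longleftrightarrow> length x = n \<and> y = f x" "length x = n \<Longrightarrow> length (f x) = n"
    "snd ` set es \<subseteq> configs n"
  using assms
  by (auto simp: graph_of_def boolean_network_def lists_graph_def functional_graph_def configs_def)

lemma trap_space_iff_edges:
  assumes "graph_of n f es" "length h = n"
  shows "trap_space n f h \<longleftrightarrow> (\<forall>(x, y)\<in>set es. x \<in> vertices h \<longrightarrow> y \<in> vertices h)"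
  using assms(2) length_vertices[of _ h]
  unfolding trap_space_def Ball_def split_paired_All case_prod_conv graph_ofD(1)[OF assms(1)] by auto

text \<open>Every sweep that changes the cube frees a coordinate, so \<open>n\<close> sweeps reach a fixed point.\<close>

lemma absorb_fixpoint:
  assumes es: "snd ` set es \<subseteq> configs n" and h: "length h = n" and N: "n \<le> N"
  shows "absorb es ((absorb es ^^ N) h) = (absorb es ^^ N) h"
proof -
  define g where "g = (\<lambda>k. (absorb es ^^ k) h)"
  have len: "length (g k) = n" for k
    using h es by (induction k) (auto simp: g_def length_absorb)
  have g_Suc: "g (Suc k) = absorb es (g k)" for k
    by (simp add: g_def)
  have star: "stars (g k) \<le> stars (g (Suc k))" "stars (g (Suc k)) \<le> stars (g k) \<Longrightarrow> g (Suc k) = g k" for k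
    using stars_absorb[of es "g k", unfolded len, OF es] unfolding g_Suc by blast+
  have "g (Suc k) = g k \<or> k \<le> stars (g k)" for k
  proof (induction k)
    case (Suc k)
    show ?case
    proof (cases "g (Suc k) = g k")
      case True
      then show ?thesis
        by (metis g_Suc)
    next
      case False
      then show ?thesis
        using Suc star[of k] by linarith
    qed
  qed simp
  moreover have "stars (g k) \<le> n" for k
    using len[of k] by (auto simp: stars_def)
  \<comment> \<open>If the sequence is not known to be stationary at \<open>N\<close>, then
    \<open>n \<le> N \<le> stars (g N) \<le> n\<close>: all coordinates are free, and the next sweep
    has none to add.\<close>
  ultimately have "g (Suc N) = g N"
    using N star(2)[of N] by (metis le_trans)
  then show ?thesis
    by (simp add: g_def)
qed

section \<open>Closures and minimality\<close>

context
  fixes n N f es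
  assumes graph: "graph_of n f es" and N: "n \<le> N"
begin

text \<open>The iteration count is \<open>N\<close>, the only one that a clocked loop offers, so
  that this is literally what the program computes.\<close>

definition trap_closure :: "bool list \<Rightarrow> hypercube" where
  "trap_closure x = (absorb es ^^ N) (map Some x)"

lemma length_closure: "length x = n \<Longrightarrow> length (trap_closure x) = n"
proof -
  assume "length x = n"
  then have "length ((absorb es ^^ k) (map Some x)) = n" for k
    using graph_ofD(3)[OF graph] by (induction k) (auto simp: length_absorb)
  then show ?thesis
    by (simp add: trap_closure_def)
qed

lemma in_closure:
  assumes x: "length x = n" shows "x \<in> vertices (trap_closure x)"
proof -
  have "x \<in> vertices ((absorb es ^^ k) (map Some x)) \<and> length ((absorb es ^^ k) (map Some x)) = n" for k
  proof (induction k)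
    case 0
    then show ?case
      using x by (simp add: in_vertices_iff list_all2_conv_all_nth)
  next
    case (Suc k)
    then show ?case
      using graph_ofD(3)[OF graph] absorb_above[of es "(absorb es ^^ k) (map Some x)"]
      by (auto simp: length_absorb)
  qed
  then show ?thesis
    by (simp add: trap_closure_def)
qed

lemma trap_space_closure:
  assumes x: "length x = n" shows "trap_space n f (trap_closure x)"
proof -
  have "absorb es (trap_closure x) = trap_closure x"
    unfolding trap_closure_def using graph_ofD(3)[OF graph] x N by (intro absorb_fixpoint) auto
  then show ?thesis
    using stars_absorb[of es "trap_closure x"] graph_ofD(3)[OF graph] length_closure[OF x]
    by (simp add: trap_space_iff_edges[OF graph])
qed

lemma trap_closure_least:
  assumes "trap_space n f h" "x \<in> vertices h" shows "vertices (trap_closure x) \<subseteq> vertices h"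
proof -
  have len: "length h = n" "length x = n"
    using assms length_vertices[of x h] by (auto simp: trap_space_def)
  have trap: "y \<in> vertices h" if "(z, y) \<in> set es" "z \<in> vertices h" for z y
    using that assms(1) trap_space_iff_edges[OF graph len(1)] by auto
  have "below ((absorb es ^^ k) (map Some x)) h" for k
  proof (induction k)
    case 0
    then show ?case
      using assms(2) by (auto simp: below_def in_vertices_iff list_all2_conv_all_nth)
  qed (use absorb_below[OF trap] in auto)
  then show ?thesis
    using vertices_mono_iff[of "trap_closure x" h] length_closure len by (simp add: trap_closure_def)
qed

lemma trap_closure_eq_minimal:
  assumes "minimal_trap_space n f h" "x \<in> vertices h" shows "trap_closure x = h"
proof -
  have trap: "trap_space n f h" and len: "length h = n" "length x = n"
    using assms length_vertices[of x h] by (auto simp: minimal_trap_space_def trap_space_def)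
  have "vertices (trap_closure x) = vertices h"
    using trap_closure_least[OF trap assms(2)] trap_space_closure[OF len(2)] assms(1)
    by (auto simp: minimal_trap_space_def)
  then show ?thesis
    using vertices_inj length_closure[OF len(2)] len(1) by metis
qed

text \<open>From right to left: \<open>h\<close> has a vertex, so it is a closure and thus a trap
  space. A trap space \<open>h'\<close> inside \<open>h\<close> has a vertex too; the closure of
  that vertex lies in \<open>h'\<close> by leastness and equals \<open>h\<close> by assumption, so
  \<open>h'\<close> is not smaller.\<close>

lemma minimal_trap_space_iff:
  assumes h: "length h = n"
  shows "minimal_trap_space n f h \<longleftrightarrow> (\<forall>x\<in>vertices h. h = trap_closure x)"
proof
  assume closures: "\<forall>x\<in>vertices h. h = trap_closure x"
  have "trap_space n f h"
    using closures fill_in_vertices[of True h] trap_space_closure[of "fill True h"] h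
    by (auto simp: fill_def)
  moreover have "vertices h \<subseteq> vertices h'" if "trap_space n f h'" "vertices h' \<subseteq> vertices h" for h'
  proof -
    have "fill True h' \<in> vertices h"
      using that(2) fill_in_vertices by blast
    then have "h = trap_closure (fill True h')"
      using closures by blast
    with trap_closure_least[OF that(1) fill_in_vertices[of True h']] show ?thesis
      by metis
  qed
  ultimately show "minimal_trap_space n f h"
    by (auto simp: minimal_trap_space_def)
qed (use trap_closure_eq_minimal in auto)

lemma in_minimal_trap_space_iff:
  assumes "length x = n"
  shows "(\<exists>h. minimal_trap_space n f h \<and> x \<in> vertices h) \<longleftrightarrow> minimal_trap_space n f (trap_closure x)"
  using trap_closure_eq_minimal in_closure[OF assms] by auto

end

text \<open>The right-hand side is what the decider can check. Being \<open>2 ^ n\<close> distinct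
  members of a set with \<open>2 ^ n\<close> elements, the sources exhaust the configurations, and
  the list read as a finite map is the network.\<close>

lemma ex_graph_of_iff:
  "(\<exists>f. graph_of n f es) \<longleftrightarrow> set es \<subseteq> configs n \<times> configs n \<and> length es = 2 ^ n \<and>
    (\<forall>(x, y)\<in>set es. length (filter ((=) x \<circ> fst) es) \<le> 1)"
proof -
  have card: "card (configs n) = 2 ^ n" "finite (configs n)"
    using card_lists_length_eq[of "UNIV :: bool set" n] finite_lists_length_eq[of "UNIV :: bool set" n]
    by (simp_all add: configs_def)
  have count: "length (filter ((=) x \<circ> fst) es) = count_list (map fst es) x" for x
    by (induction es) auto
  have single: "(\<forall>(x, y)\<in>set es. length (filter ((=) x \<circ> fst) es) \<le> 1) \<longleftrightarrow> distinct (map fst es)"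
  proof -
    have "(\<forall>x\<in>set xs. count_list xs x \<le> 1) \<longleftrightarrow> distinct xs" for xs :: "bool list list"
      by (induction xs) (auto simp: count_list_0_iff)
    from this[of "map fst es"] show ?thesis
      unfolding count by (simp add: split_beta)
  qed
  show ?thesis
    unfolding single
  proof safe
    fix f assume graph: "graph_of n f es"
    note g = graph_ofD[OF graph]
    show "x \<in> configs n" "y \<in> configs n" if "(x, y) \<in> set es" for x y
      using that g by (auto simp: configs_def)
    show dist: "distinct (map fst es)"
      using graph g(1) by (auto simp: distinct_map graph_of_def lists_graph_def inj_on_def)
    have "x \<in> fst ` set es \<longleftrightarrow> (\<exists>y. (x, y) \<in> set es)" for x
      by force
    then have "fst ` set es = configs n"
      unfolding set_eq_iff g(1) by (simp add: configs_def)
    then show "length es = 2 ^ n"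
      using distinct_card[OF dist] card by simp
  next
    assume es: "set es \<subseteq> configs n \<times> configs n" "length es = 2 ^ n" and dist: "distinct (map fst es)"
    have "fst ` set es = configs n"
      using es card distinct_card[OF dist] by (intro card_subset_eq) auto
    \<comment> \<open>Distinct sources make \<open>map_of\<close> agree with membership in the list.
      Outside \<open>configs n\<close> the value is \<open>the None\<close>, on which
      \<open>boolean_network\<close> imposes no condition.\<close>
    define f where "f = (\<lambda>x. the (map_of es x))"
    have f: "(x, y) \<in> set es \<longleftrightarrow> x \<in> configs n \<and> y = f x" for x y
    proof -
      have "(x, y) \<in> set es \<longleftrightarrow> map_of es x = Some y"
        using map_of_eq_Some_iff[OF dist, of x y] by blast
      moreover have "x \<in> configs n \<longleftrightarrow> map_of es x \<noteq> None"
        unfolding map_of_eq_None_iff \<open>fst ` set es = configs n\<close> by simp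
      ultimately show ?thesis
        by (auto simp: f_def)
    qed
    then have "graph_of n f es"
      using es(1) dist unfolding graph_of_def boolean_network_def lists_graph_def functional_graph_def
      by (auto simp: distinct_map)
    then show "\<exists>f. graph_of n f es"
      by blast
  qed
qed

section \<open>Encodings and the main theorem\<close>

definition bits :: "bool list \<Rightarrow> nat list" where
  "bits x = map (\<lambda>b. encode_entry (Some b)) x"

definition symbols :: "hypercube \<Rightarrow> nat list" where
  "symbols h = map encode_entry h"

definition edge_words :: "edges \<Rightarrow> (nat list \<times> nat list) list" where
  "edge_words es = map (map_prod bits bits) es"

lemma encode_entry_cases: "encode_entry a \<in> {1, 2, 3}"
  by (cases a rule: encode_entry.cases) auto

lemma encode_entry_eq_3 [simp]: "encode_entry a = 3 \<longleftrightarrow> a = None"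
  by (cases a rule: encode_entry.cases) auto

lemma encode_entry_inject [simp]: "encode_entry a = encode_entry b \<longleftrightarrow> a = b"
  by (cases a rule: encode_entry.cases; cases b rule: encode_entry.cases) auto

lemma bits_eq_symbols: "bits x = symbols (map Some x)"
  by (simp add: bits_def symbols_def)

lemma symbols_inject [simp]: "symbols g = symbols h \<longleftrightarrow> g = h"
  by (simp add: symbols_def inj_map_eq_map inj_def)

lemma length_symbols [simp]: "length (symbols h) = length h"
  by (simp add: symbols_def)

lemma length_bits [simp]: "length (bits x) = length x"
  by (simp add: bits_def)

lemma cube_iff: "cube n g \<longleftrightarrow> (\<exists>h. length h = n \<and> g = symbols h)"
proof
  assume g: "cube n g"
  define decode where "decode = (\<lambda>s. if s = 3 then None else Some (s = (2 :: nat)))"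
  have "g = symbols (map decode g)"
    using g unfolding symbols_def map_map
    by (intro map_idI[symmetric]) (auto simp: cube_def decode_def)
  then show "\<exists>h. length h = n \<and> g = symbols h"
    using g by (intro exI[of _ "map decode g"]) (simp add: cube_def)
next
  have "set (symbols h) \<subseteq> {1, 2, 3}" for h
    unfolding symbols_def using encode_entry_cases by (simp only: set_map) blast
  then show "\<exists>h. length h = n \<and> g = symbols h \<Longrightarrow> cube n g"
    unfolding cube_def by auto
qed

lemma vec_iff: "vec n v \<longleftrightarrow> (\<exists>x. length x = n \<and> v = bits x)"
proof
  assume v: "vec n v"
  then have "v = bits (map (\<lambda>s. s = 2) v)"
    unfolding bits_def map_map by (intro map_idI[symmetric]) (auto simp: vec_def)
  then show "\<exists>x. length x = n \<and> v = bits x"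
    using v by (intro exI[of _ "map (\<lambda>s. s = 2) v"]) (simp add: vec_def)
next
  have "encode_entry (Some b) \<in> {1, 2}" for b
    by (cases b) auto
  then have "set (bits x) \<subseteq> {1, 2}" for x
    unfolding bits_def by (simp only: set_map) blast
  then show "\<exists>x. length x = n \<and> v = bits x \<Longrightarrow> vec n v"
    unfolding vec_def by auto
qed

lemma vec_bits: "vec n (bits x) \<longleftrightarrow> length x = n"
  using vec_iff[of n "bits x"] length_bits by metis

lemma vec_symbols_iff: "vec n (symbols h) \<longleftrightarrow> length h = n \<and> None \<notin> set h"
proof -
  have eq: "encode_entry a \<in> {1, 2} \<longleftrightarrow> a \<noteq> None" for a
    by (cases a rule: encode_entry.cases) auto
  have "set (symbols h) \<subseteq> {1, 2} \<longleftrightarrow> (\<forall>a\<in>set h. a \<noteq> None)"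
    unfolding symbols_def set_map image_subset_iff eq ..
  then show ?thesis
    unfolding vec_def by auto
qed

lemma edge_words_iff:
  "set es' \<subseteq> Collect (vec n) \<times> Collect (vec n) \<longleftrightarrow>
    (\<exists>es. set es \<subseteq> configs n \<times> configs n \<and> es' = edge_words es)"
proof
  assume "set es' \<subseteq> Collect (vec n) \<times> Collect (vec n)"
  then show "\<exists>es. set es \<subseteq> configs n \<times> configs n \<and> es' = edge_words es"
  proof (induction es')
    case (Cons e es')
    then obtain x y es where "e = (bits x, bits y)" "x \<in> configs n" "y \<in> configs n"
      "set es \<subseteq> configs n \<times> configs n" "es' = edge_words es"
      by (cases e) (auto simp: vec_iff configs_def)
    then show ?case
      by (intro exI[of _ "(x, y) # es"]) (auto simp: edge_words_def)
  qed (simp add: edge_words_def)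
qed (fastforce simp: edge_words_def vec_bits configs_def)

lemma vmatch_symbols: "vmatch (symbols h) (bits x) \<longleftrightarrow> x \<in> vertices h"
  by (simp add: vmatch_def in_vertices_iff symbols_def bits_def list_all2_map1 list_all2_map2)

lemma vmatch_bits: "vmatch (bits x) (bits y) \<longleftrightarrow> x = y"
  by (simp add: bits_eq_symbols[of x] vmatch_symbols in_vertices_iff list_all2_map1 list_all2_eq)

lemma vjoin_symbols: "vjoin (symbols h) (bits y) = symbols (join_config h y)"
  unfolding vjoin_def symbols_def bits_def join_config_def zip_map_map map_map
  by (rule map_cong) auto

text \<open>Here the words handled by the programs meet the sub-hypercubes: matching and joining
  commute with the encoding, hence so do whole sweeps.\<close>

lemma sweep_join_symbols: "sweep_join (edge_words es) (symbols h) = symbols (absorb es h)"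
  by (induction es arbitrary: h)
    (auto simp: sweep_join_def edge_words_def vmatch_symbols vjoin_symbols)

lemma sweep_joins_symbols:
  "(sweep_join (edge_words es) ^^ k) (symbols h) = symbols ((absorb es ^^ k) h)"
  by (induction k) (auto simp: sweep_join_symbols)

lemma encode_word:
  "encode_hypercube h @ encode_edges es = symbols h @ 4 # words (edge_words es)"
proof -
  have "encode_edges es = words (edge_words es)"
    by (induction es) (auto simp: encode_edges_def edge_words_def encode_config_def bits_def)
  then show ?thesis
    by (simp add: encode_hypercube_def symbols_def)
qed

lemma encode_config_eq: "encode_config x = encode_hypercube (map Some x)"
  by (simp add: encode_config_def encode_hypercube_def)

lemma encode_in_lists: "encode_hypercube h @ encode_edges es \<in> lists {1..4}"
proof -
  have "encode_entry a \<in> {1..4}" for a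
    using encode_entry_cases[of a] by auto
  then show ?thesis
    by (auto simp: encode_hypercube_def encode_edges_def encode_config_def)
qed

text \<open>The bound \<open>n \<le> N\<close> is recorded on the right because it guarantees that
  \<open>N\<close> sweeps reach the closure. The fact \<open>main\<close> is proved for every
  decomposition of \<open>w\<close>, so it applies both to the one found by parsing and to the one
  given by membership in the language.\<close>

lemma decider_accepts_iff:
  assumes w: "w \<in> lists {1..4}" and N: "N = length w"
    and prep: "\<forall>n es h. edges_ok N n es \<longrightarrow> cube n h \<longrightarrow> prep_spec N n es h prep (P es h)"
    and check: "\<forall>n es h. edges_ok N n es \<longrightarrow> cube n h \<longrightarrow> check_spec N n es h check (bad es h)"
  shows "peek (eval N (decider strict prep check) ((\<lambda>_. [])(0 := w)) rB) = 0 \<longleftrightarrow>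
    (\<exists>n f h es. w = encode_hypercube h @ encode_edges es \<and> graph_of n f es \<and> length h = n \<and>
      n \<le> N \<and> (strict \<longrightarrow> None \<notin> set h) \<and>
      (\<forall>(x, y)\<in>set es. \<not> bad (edge_words es) (P (edge_words es) (symbols h)) (bits x) (bits y)))"
    (is "?accept \<longleftrightarrow> _")
proof -
  have main: "?accept \<longleftrightarrow> (\<exists>f. graph_of n f es) \<and>
      (\<forall>(x, y)\<in>set es. \<not> bad (edge_words es) (P (edge_words es) (symbols h)) (bits x) (bits y))"
    if w_eq: "w = encode_hypercube h @ encode_edges es" and h: "length h = n" "strict \<longrightarrow> None \<notin> set h"
      and es: "set es \<subseteq> configs n \<times> configs n" for n h es
  proof -
    have vecs: "set (edge_words es) \<subseteq> Collect (vec n) \<times> Collect (vec n)"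
      using es edge_words_iff by blast
    have valid: "valid_input strict n (symbols h) (edge_words es)"
      using h vecs cube_iff vec_symbols_iff by (auto simp: valid_input_def)
    have len: "N = length (symbols h @ 4 # words (edge_words es))"
      using w_eq N by (simp add: encode_word)
    have ok: "edges_ok N n (edge_words es)"
      using vecs h len by (simp add: edges_ok_def symbols_def)
    have "cube n (symbols h)"
      using valid by (simp add: valid_input_def)
    note prep = prep[rule_format, OF ok this]
    then have "cube n (P (edge_words es) (symbols h))"
      by (simp add: prep_spec_def)
    note check = check[rule_format, OF ok this]
    have ball: "(\<forall>e\<in>set (edge_words es). Q e) \<longleftrightarrow> (\<forall>(x, y)\<in>set es. Q (bits x, bits y))" for Q
      by (auto simp: edge_words_def)
    have length: "length (edge_words es) = length es"
      by (simp add: edge_words_def)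
    have count: "length (filter (vmatch (bits x) \<circ> fst) (edge_words es)) = length (filter ((=) x \<circ> fst) es)" for x
      by (simp add: edge_words_def filter_map comp_def vmatch_bits)
    show ?thesis
      using eval_decider_valid[OF valid len prep check] es
      unfolding w_eq encode_word ex_graph_of_iff ball case_prod_conv count length
      by (simp add: split_beta ball_conj_distrib)
  qed
  show ?thesis
  proof
    assume ?accept
    then obtain n g es' where g: "w = g @ 4 # words es'" "valid_input strict n g es'"
      using accepted_input_valid[OF w] N by metis
    then obtain h es where h: "length h = n" "g = symbols h" and
      es: "set es \<subseteq> configs n \<times> configs n" "es' = edge_words es"
      unfolding valid_input_def cube_iff edge_words_iff by auto
    have w_eq: "w = encode_hypercube h @ encode_edges es" and "n \<le> N"
      using g h es N by (auto simp: encode_word symbols_def)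
    moreover have "strict \<longrightarrow> None \<notin> set h"
      using g h vec_symbols_iff by (auto simp: valid_input_def)
    ultimately show "\<exists>n f h es. w = encode_hypercube h @ encode_edges es \<and> graph_of n f es \<and> length h = n \<and>
      n \<le> N \<and> (strict \<longrightarrow> None \<notin> set h) \<and>
      (\<forall>(x, y)\<in>set es. \<not> bad (edge_words es) (P (edge_words es) (symbols h)) (bits x) (bits y))"
      using main[OF w_eq h(1) _ es(1)] \<open>?accept\<close> h(1) by blast
  next
    assume "\<exists>n f h es. w = encode_hypercube h @ encode_edges es \<and> graph_of n f es \<and> length h = n \<and>
      n \<le> N \<and> (strict \<longrightarrow> None \<notin> set h) \<and>
      (\<forall>(x, y)\<in>set es. \<not> bad (edge_words es) (P (edge_words es) (symbols h)) (bits x) (bits y))"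
    then obtain n f h es where *: "w = encode_hypercube h @ encode_edges es" "graph_of n f es" "length h = n"
      "strict \<longrightarrow> None \<notin> set h"
      "\<forall>(x, y)\<in>set es. \<not> bad (edge_words es) (P (edge_words es) (symbols h)) (bits x) (bits y)"
      by blast
    have "set es \<subseteq> configs n \<times> configs n"
      using *(2) ex_graph_of_iff by blast
    from main[OF *(1,3,4) this] * show ?accept
      by blast
  qed
qed

lemma wf_on_sym [simp]:
  "wf_cmd R S (on_sym i c) \<longleftrightarrow> i < R \<and> wf_cmd R S (c 1) \<and> wf_cmd R S (c 2) \<and>
    wf_cmd R S (c 3) \<and> wf_cmd R S (c 4)"
  by (auto simp: on_sym_def)

text \<open>17 accounts for the registers 0 to 16, and 5 for the blank together with the input
  symbols 1 to 4.\<close>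

lemma wf_decider:
  assumes "wf_cmd 17 5 prep" "wf_cmd 17 5 check"
  shows "wf_cmd 17 5 (decider strict prep check)"
  using assms
  by (simp add: decider_def header_def raise_def flush_def validator_def vec_parser_def unpack_def
      power_check_def halve_def clear_def source_loop_def source_step_def walk_def count_pass_def
      edge_loop_def)

lemma wf_join_pass: "wf_cmd 17 5 join_pass"
  by (simp add: join_pass_def edge_loop_def walk_def join_def flush_def raise_def)

lemma wf_checks:
  "wf_cmd 17 5 trap_check" "wf_cmd 17 5 closure_check" "wf_cmd 17 5 initial_closure"
  using wf_join_pass
  by (simp_all add: trap_check_def closure_check_def initial_closure_def clear_def walk_def flush_def raise_def)

lemma polytime_decidable_by_decider:
  assumes sub: "L \<subseteq> lists {1..4}" and "wf_cmd 17 5 prep" "wf_cmd 17 5 check"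
    and "\<And>w. w \<in> lists {1..4} \<Longrightarrow>
      peek (eval (length w) (decider strict prep check) ((\<lambda>_. [])(0 := w)) rB) = 0 \<longleftrightarrow> w \<in> L"
  shows "polytime_decidable 4 L"
  by (rule polytime_decidable_by_cmd[where R = 17 and r = rB and c = "decider strict prep check"])
    (use assms wf_decider in auto)

lemma prep_Skip: "\<forall>n es h. edges_ok N n es \<longrightarrow> cube n h \<longrightarrow> prep_spec N n es h Skip h"
  by (simp add: prep_spec_Skip)

lemma prep_closure: "\<forall>n es h. edges_ok N n es \<longrightarrow> cube n h \<longrightarrow>
    prep_spec N n es h initial_closure ((sweep_join es ^^ N) h)"
  by (simp add: prep_spec_initial_closure)

lemma check_closure: "\<forall>n es h. edges_ok N n es \<longrightarrow> cube n h \<longrightarrow>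
    check_spec N n es h closure_check (\<lambda>x y. vmatch h x \<and> h \<noteq> (sweep_join es ^^ N) x)"
  by (simp add: check_spec_closure)

section \<open>The three problems\<close>

lemma polytime_TRAPSPACE: "polytime_decidable 4 TRAPSPACE"
proof (rule polytime_decidable_by_decider[where strict = False and prep = Skip and check = trap_check])
  show "TRAPSPACE \<subseteq> lists {1..4}"
    unfolding TRAPSPACE_def using encode_in_lists by blast
next
  fix w :: "nat list" assume w: "w \<in> lists {1..4}"
  have "(\<forall>(x, y)\<in>set es. \<not> (vmatch (symbols h) (bits x) \<and> \<not> vmatch (symbols h) (bits y))) \<longleftrightarrow>
      trap_space n f h" if "graph_of n f es" "length h = n" for n f h es
    unfolding trap_space_iff_edges[OF that] vmatch_symbols by auto
  moreover have "n \<le> length w" if "w = encode_hypercube h @ encode_edges es" "length h = n" for n h es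
    using that by (simp add: encode_hypercube_def)
  moreover have check: "\<forall>n es h. edges_ok (length w) n es \<longrightarrow> cube n h \<longrightarrow>
      check_spec (length w) n es h trap_check (\<lambda>x y. vmatch h x \<and> \<not> vmatch h y)"
    by (simp add: check_spec_trap edges_ok_def)
  ultimately show "peek (eval (length w) (decider False Skip trap_check) ((\<lambda>_. [])(0 := w)) rB) = 0 \<longleftrightarrow>
      w \<in> TRAPSPACE"
    unfolding decider_accepts_iff[OF w refl prep_Skip check] TRAPSPACE_def graph_of_def
    by blast
qed (simp_all add: wf_checks)

text \<open>Every configuration is the source of an edge, so the edges whose source lies in
  \<open>h\<close> range over exactly the vertices of \<open>h\<close>, and
  \<open>minimal_trap_space_iff\<close> applies.\<close>

lemma minimal_trap_space_iff_symbols: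
  assumes "graph_of n f es" "length h = n" "n \<le> N"
  shows "(\<forall>(x, y)\<in>set es. \<not> (vmatch (symbols h) (bits x) \<and>
      symbols h \<noteq> (sweep_join (edge_words es) ^^ N) (bits x))) \<longleftrightarrow> minimal_trap_space n f h"
  using length_vertices[of _ h] assms(2)
  unfolding minimal_trap_space_iff[OF assms(1,3,2)] bits_eq_symbols[symmetric] vmatch_symbols
  unfolding bits_eq_symbols sweep_joins_symbols symbols_inject trap_closure_def[OF assms(1,3)] Ball_def
    split_paired_All case_prod_conv graph_ofD(1)[OF assms(1)]
  by auto

lemma polytime_MINTRAP: "polytime_decidable 4 MINTRAP"
proof (rule polytime_decidable_by_decider[where strict = False and prep = Skip and check = closure_check])
  show "MINTRAP \<subseteq> lists {1..4}"
    unfolding MINTRAP_def using encode_in_lists by blast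
next
  fix w :: "nat list" assume w: "w \<in> lists {1..4}"
  have "n \<le> length w" if "w = encode_hypercube h @ encode_edges es" "length h = n" for n h es
    using that by (simp add: encode_hypercube_def)
  then show "peek (eval (length w) (decider False Skip closure_check) ((\<lambda>_. [])(0 := w)) rB) = 0 \<longleftrightarrow>
      w \<in> MINTRAP"
    unfolding decider_accepts_iff[OF w refl prep_Skip check_closure] MINTRAP_def
    using minimal_trap_space_iff_symbols[of _ _ _ _ "length w"] unfolding graph_of_def by blast
qed (simp_all add: wf_checks)

text \<open>The strict header admits configurations only; the preparation replaces the configuration
  by its closure, and minimality of that closure is decided by the same test as for
  \<open>MINTRAP\<close>.\<close>

lemma polytime_IN_MINTRAP: "polytime_decidable 4 IN_MINTRAP"
proof (rule polytime_decidable_by_decider[where strict = True and prep = initial_closure and check = closure_check])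
  show "IN_MINTRAP \<subseteq> lists {1..4}"
    using encode_in_lists unfolding IN_MINTRAP_def encode_config_eq by blast
next
  fix w :: "nat list" assume w: "w \<in> lists {1..4}"
  define N where "N = length w"
  have bad: "(\<forall>(u, v)\<in>set es. \<not> (vmatch ((sweep_join (edge_words es) ^^ N) (symbols (map Some x))) (bits u) \<and>
      (sweep_join (edge_words es) ^^ N) (symbols (map Some x)) \<noteq> (sweep_join (edge_words es) ^^ N) (bits u))) \<longleftrightarrow>
      (\<exists>h. minimal_trap_space n f h \<and> x \<in> vertices h)"
    if "graph_of n f es" "length x = n" "n \<le> N" for n f x es
    using minimal_trap_space_iff_symbols[OF that(1) length_closure[OF that(1,3,2)] that(3)]
    unfolding in_minimal_trap_space_iff[OF that(1,3,2)] trap_closure_def[OF that(1,3)] sweep_joins_symbols by simp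
  have cube: "(length h = n \<and> None \<notin> set h) \<longleftrightarrow> (\<exists>x. length x = n \<and> h = map Some x)" for n and h :: hypercube
  proof -
    have "h = map Some (map the h)" if "None \<notin> set h"
      unfolding map_map using that by (intro map_idI[symmetric]) (metis comp_apply option.collapse)
    then show ?thesis
      by (metis ex_map_conv length_map option.distinct(1))
  qed
  have len: "n \<le> N" if "w = encode_hypercube (map Some x) @ encode_edges es" "length x = n" for n x es
    using that by (simp add: encode_hypercube_def N_def)
  have "peek (eval N (decider True initial_closure closure_check) ((\<lambda>_. [])(0 := w)) rB) = 0 \<longleftrightarrow>
      (\<exists>n f x es. w = encode_hypercube (map Some x) @ encode_edges es \<and> graph_of n f es \<and> length x = n \<and>
        n \<le> N \<and> (\<exists>h. minimal_trap_space n f h \<and> x \<in> vertices h))"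
    unfolding decider_accepts_iff[OF w N_def prep_closure check_closure]
  proof (intro iffI; elim exE conjE)
    fix n f h es
    assume *: "graph_of n f es" "n \<le> N" and len: "length h = n" "True \<longrightarrow> None \<notin> set h"
      and w: "w = encode_hypercube h @ encode_edges es"
      and good: "\<forall>(u, v)\<in>set es. \<not> (vmatch ((sweep_join (edge_words es) ^^ N) (symbols h)) (bits u) \<and>
        (sweep_join (edge_words es) ^^ N) (symbols h) \<noteq> (sweep_join (edge_words es) ^^ N) (bits u))"
    obtain x where x: "length x = n" "h = map Some x"
      using len cube by blast
    show "\<exists>n f x es. w = encode_hypercube (map Some x) @ encode_edges es \<and> graph_of n f es \<and>
        length x = n \<and> n \<le> N \<and> (\<exists>h. minimal_trap_space n f h \<and> x \<in> vertices h)"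
      using bad[OF *(1) x(1) *(2)] good * w x(1) unfolding x(2) by blast
  next
    fix n f x es h
    assume *: "graph_of n f es" "length x = n" "n \<le> N"
      and w: "w = encode_hypercube (map Some x) @ encode_edges es"
      and h: "minimal_trap_space n f h" "x \<in> vertices h"
    show "\<exists>n f h es. w = encode_hypercube h @ encode_edges es \<and> graph_of n f es \<and> length h = n \<and>
        n \<le> N \<and> (True \<longrightarrow> None \<notin> set h) \<and>
        (\<forall>(u, v)\<in>set es. \<not> (vmatch ((sweep_join (edge_words es) ^^ N) (symbols h)) (bits u) \<and>
          (sweep_join (edge_words es) ^^ N) (symbols h) \<noteq> (sweep_join (edge_words es) ^^ N) (bits u)))"
      using iffD2[OF bad[OF *]] h * w by (intro exI[of _ n] exI[of _ f] exI[of _ "map Some x"] exI[of _ es]) auto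
  qed
  also have "\<dots> \<longleftrightarrow> w \<in> IN_MINTRAP"
    unfolding IN_MINTRAP_def graph_of_def encode_config_eq configs_def using len by blast
  finally show "peek (eval (length w) (decider True initial_closure closure_check) ((\<lambda>_. [])(0 := w)) rB) = 0 \<longleftrightarrow>
      w \<in> IN_MINTRAP"
    by (simp only: N_def)
qed (simp_all add: wf_checks)

theorem theorem7:
  "polytime_decidable 4 TRAPSPACE \<and> polytime_decidable 4 MINTRAP \<and> polytime_decidable 4 IN_MINTRAP"
  using polytime_TRAPSPACE polytime_MINTRAP polytime_IN_MINTRAP by blast

end
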